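(* Let $n\ge1$ be an integer, let $\sigma$ be a real number with $0<\sigma<n/2$, let $\Sigma\subset\mathbb{R}^n$ be a smooth $k$-dimensional closed manifold with $k\le n-1$, let $N$ be a tubular neighborhood of $\Sigma$, let $\Pi$ be the orthogonal projection of $N$ onto $\Sigma$, and for small $r>0$ and $z\in\Sigma$ let $\Pi_r^{-1}(z)=\{y\in N\mid \Pi(y)=z,\ |y-z|=r\}$. Let $h\in C^1(B_2)$ be a positive function and let $u\in L^{\frac{n+2\sigma}{n-2\sigma}}(B_2)\cap C(B_2\setminus\Sigma)$ be a positive solution of $$u(x)=\int_{B_2}\frac{u(y)^{\frac{n+2\sigma}{n-2\sigma}}}{|x-y|^{n-2\sigma}}\,dy+h(x),\qquad x\in B_2\setminus\Sigma.$$ Let $A\subset B_2$ be a compact subset of $\Sigma$. Then, for $x,x'\in\Pi_r^{-1}(z)$, $$u(x)=u(x')\,(1+O(r))\quad\text{as }r\to0^+,$$ where $O(r)$ is uniform for all $z\in A$; that is, there exist constants $C>0$ and $r_0>0$ such that $|u(x)/u(x')-1|\le Cr$ for all $0<r<r_0$, all $z\in A$ and all $x,x'\in\Pi_r^{-1}(z)$.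
   Context: $B_r$ denotes the open ball of radius $r$ centered at the origin in $\mathbb{R}^n$. A closed manifold here means a compact smooth submanifold of $\mathbb{R}^n$ without boundary; $\Sigma$ is allowed to intersect $\partial B_2$. The tubular neighborhood $N$ of $\Sigma$ is such that any point of $N$ can be uniquely expressed as a sum $x+v$ with $x\in\Sigma$ and $v\in(T_x\Sigma)^\perp$, the orthogonal complement of the tangent space of $\Sigma$ at $x$; the orthogonal projection $\Pi$ sends this point to $x$. *)

theory Defs
  imports "HOL-Analysis.Analysis"
begin

text \<open>
  C^m regularity on an open set. The recursion says that all iterated directional derivatives
  up to order m exist and are continuous. Only meant for open sets, since the derivatives are
  taken in the full space.
\<close>

primrec Ck_on :: "nat \<Rightarrow> ('a::euclidean_space \<Rightarrow> 'b::euclidean_space) \<Rightarrow> 'a set \<Rightarrow> bool" where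
  "Ck_on 0 f S \<longleftrightarrow> continuous_on S f"
| "Ck_on (Suc m) f S \<longleftrightarrow>
     (\<forall>x\<in>S. f differentiable (at x)) \<and>
     (\<forall>v. Ck_on m (\<lambda>x. frechet_derivative f (at x) v) S)"

definition smooth_on :: "('a::euclidean_space \<Rightarrow> 'b::euclidean_space) \<Rightarrow> 'a set \<Rightarrow> bool" where
  "smooth_on f S \<longleftrightarrow> (\<forall>m. Ck_on m f S)"

text \<open>
  Embedded smooth submanifolds without boundary, by slice charts. The model space is an
  arbitrary k-dimensional linear subspace \<open>L\<close> instead of a fixed coordinate subspace; the two
  differ by a linear change of coordinates.
\<close>

definition smooth_submanifold :: "nat \<Rightarrow> 'a::euclidean_space set \<Rightarrow> bool" where
  "smooth_submanifold k M \<longleftrightarrow>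
     (\<forall>p\<in>M. \<exists>U W \<phi> \<psi> L.
        open U \<and> p \<in> U \<and> open (W :: 'a set) \<and>
        homeomorphism U W \<phi> \<psi> \<and> smooth_on \<phi> U \<and> smooth_on \<psi> W \<and>
        subspace L \<and> dim L = k \<and> \<phi> ` (U \<inter> M) = W \<inter> L)"

definition closed_manifold :: "nat \<Rightarrow> 'a::euclidean_space set \<Rightarrow> bool" where
  "closed_manifold k M \<longleftrightarrow> smooth_submanifold k M \<and> compact M"

definition tangent_space :: "'a::euclidean_space set \<Rightarrow> 'a \<Rightarrow> 'a set" where
  "tangent_space M x =
     {v. \<exists>(\<gamma> :: real \<Rightarrow> 'a) e. e > 0 \<and> smooth_on \<gamma> {-e<..<e} \<and> \<gamma> ` {-e<..<e} \<subseteq> M \<and>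
         \<gamma> 0 = x \<and> (\<gamma> has_vector_derivative v) (at 0)}"

definition normal_bundle :: "'a::euclidean_space set \<Rightarrow> ('a \<times> 'a) set" where
  "normal_bundle M = {(x, v). x \<in> M \<and> v \<in> orthogonal_comp (tangent_space M x)}"

text \<open>
  \<open>N\<close> is a tubular neighborhood of \<open>M\<close> with orthogonal projection \<open>P\<close>: for some open
  neighborhood \<open>V\<close> of the zero section in the normal bundle, every point of the open set \<open>N\<close> is
  uniquely \<open>x + v\<close> with \<open>(x, v)\<close> in \<open>V\<close>, and \<open>P\<close> sends it to \<open>x\<close>. Restricting to \<open>V\<close> is
  essential: with normal vectors of arbitrary length the representation is not unique (the
  antipodal point of a sphere gives a second one). The addition map need not be a
  diffeomorphism from \<open>V\<close> onto \<open>N\<close>, so the usual tubular neighborhoods are all included.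
\<close>

definition tubular_neighborhood ::
    "'a::euclidean_space set \<Rightarrow> 'a set \<Rightarrow> ('a \<Rightarrow> 'a) \<Rightarrow> bool" where
  "tubular_neighborhood M N P \<longleftrightarrow>
     open N \<and>
     (\<exists>V. openin (top_of_set (normal_bundle M)) V \<and> (\<forall>x\<in>M. (x, 0) \<in> V) \<and>
          bij_betw (\<lambda>(x, v). x + v) V N \<and> (\<forall>(x, v)\<in>V. P (x + v) = x))"

definition fibre_sphere :: "'a::euclidean_space set \<Rightarrow> ('a \<Rightarrow> 'a) \<Rightarrow> real \<Rightarrow> 'a \<Rightarrow> 'a set" where
  "fibre_sphere N P r z = {y \<in> N. P y = z \<and> norm (y - z) = r}"

definition in_Lp :: "real \<Rightarrow> 'a::euclidean_space set \<Rightarrow> ('a \<Rightarrow> real) \<Rightarrow> bool" where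
  "in_Lp p S u \<longleftrightarrow>
     set_borel_measurable lebesgue S u \<and> set_integrable lebesgue S (\<lambda>x. \<bar>u x\<bar> powr p)"

end

theory Submission
  imports Defs
begin

text \<open>
  Write \<open>a = n - 2 \<sigma>\<close>. The method of moving spheres compares \<open>u\<close> with its Kelvin transforms
  \<open>u\<^bsub>x,l\<^esub> y = (l / |y - x|) powr a * u (x + l\<^sup>2 (y - x) / |y - x|\<^sup>2)\<close>. Since the integral equation is
  conformally covariant, \<open>u - u\<^bsub>x,l\<^esub>\<close> satisfies an integral inequality with a positive kernel, in which
  the positive term \<open>h\<close> absorbs the contribution of the complement of a ball around \<open>x\<close>. So
  \<open>u\<^bsub>x,l\<^esub> \<le> u\<close> outside the sphere of radius \<open>l\<close> continues to hold as \<open>l\<close> grows, as long as the sphere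
  does not reach \<open>\<Sigma>\<close> and \<open>l powr a * u\<close> stays small near \<open>x\<close>. A doubling argument with the same
  spheres gives \<open>u \<le> C * d powr (- a / 2)\<close>, where \<open>d\<close> is the distance to \<open>\<Sigma>\<close>, so all spheres up to
  radius \<open>d x\<close> are admissible. For \<open>x1\<close>, \<open>x2\<close> on a fibre sphere over \<open>z\<close>, at distance \<open>\<tau> \<le> 2 r\<close>, take
  \<open>x = x1 + (b / \<tau>) (x1 - x2)\<close> with a fixed small \<open>b\<close>. The inversion with \<open>l\<^sup>2 = b (b + \<tau>)\<close> exchanges
  \<open>x1\<close> and \<open>x2\<close>, and \<open>|x - z|\<^sup>2 = r\<^sup>2 + l\<^sup>2\<close> with \<open>x - z\<close> normal to \<open>\<Sigma>\<close>, so the sphere is admissible and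
  \<open>(b / (b + \<tau>)) powr (a / 2) * u x1 \<le> u x2\<close>.
\<close>

section \<open>Inversions\<close>

text \<open>Only continuity of \<open>u\<close> off \<Sigma> is available, and nothing outside the
  domain. Spheres are therefore compared only inside \<open>ball x \<rho>\<close>, which shapes the
  proof in two ways. (1) Points within \<open>l^2 / \<rho>\<close> of \<open>x\<close> are
  reflections of points outside \<open>ball x \<rho>\<close>, so the negative kernel there has no
  partner to cancel against. This loss and the gain from \<open>h\<close> both carry the factor
  \<open>1 - (l / |y - x|) powr (a / 2)\<close>. Smallness of \<open>l powr a * u\<close> near
  \<open>x\<close> lets half of the gain pay for the loss; the other half is a strict gap away from
  the sphere. (2) Neither the start nor the continuation of the spheres differentiates
  \<open>u\<close>: near the sphere the comparison comes from the smallness of Riesz potentials of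
  thin annuli, and farther out from \<open>h\<close> at the start and from the strict gap later. The
  critical relation \<open>a * p + a = 2 * n\<close> keeps the estimates independent of
  \<open>l\<close>. The final error is linear in \<open>r\<close> because \<open>b\<close> stays
  fixed while \<open>\<tau> \<le> 2 * r\<close>.\<close>

definition inversion :: "'a::real_inner \<Rightarrow> real \<Rightarrow> 'a \<Rightarrow> 'a" where
  "inversion x l y = x + (l\<^sup>2 / (norm (y - x))\<^sup>2) *\<^sub>R (y - x)"

text \<open>This includes \<open>y = x\<close>: division by zero makes
  \<open>inversion x l x = x\<close>, and both sides are 0.\<close>

lemma norm_inversion_center:
  "norm (inversion x l y - x) = l\<^sup>2 / norm (y - x)"
  by (simp add: inversion_def power2_eq_square)

lemma inversion_inversion:
  assumes "y \<noteq> x" "l \<noteq> 0"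
  shows "inversion x l (inversion x l y) = y"
proof -
  have nz: "norm (y - x) \<noteq> 0" using assms by simp
  have "inversion x l (inversion x l y)
      = x + (l\<^sup>2 / (l\<^sup>2 / norm (y - x))\<^sup>2 * (l\<^sup>2 / (norm (y - x))\<^sup>2)) *\<^sub>R (y - x)"
    unfolding inversion_def[of x l "inversion x l y"] norm_inversion_center
    by (simp add: inversion_def)
  also have "l\<^sup>2 / (l\<^sup>2 / norm (y - x))\<^sup>2 * (l\<^sup>2 / (norm (y - x))\<^sup>2) = 1"
    using nz assms(2) by (simp add: field_simps power2_eq_square)
  finally show ?thesis by simp
qed

text \<open>With the centre moved to 0, both sides expand to the same polynomial in inner products.
  The factored right side shows the sign needed for the kernel, and the other distance identities
  follow from it.\<close>

lemma inversion_dist_sq: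
  assumes "y \<noteq> x"
  shows "(norm (y - x))\<^sup>2 * (norm (inversion x l y - v))\<^sup>2 - l\<^sup>2 * (norm (y - v))\<^sup>2
    = ((norm (y - x))\<^sup>2 - l\<^sup>2) * ((norm (v - x))\<^sup>2 - l\<^sup>2)"
proof -
  define Y where "Y = y - x"
  define V where "V = v - x"
  have Y: "Y \<bullet> Y \<noteq> 0" using assms by (simp add: Y_def)
  have 1: "inversion x l y - v = (l\<^sup>2 / (Y \<bullet> Y)) *\<^sub>R Y - V"
    by (simp add: inversion_def Y_def V_def power2_norm_eq_inner)
  have 2: "y - v = Y - V" by (simp add: Y_def V_def)
  show ?thesis
    unfolding 1 2 Y_def[symmetric] V_def[symmetric] power2_norm_eq_inner
    using Y by (simp add: inner_diff_left inner_diff_right inner_commute field_simps power2_eq_square)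
qed

text \<open>Two uses of \<open>inversion_dist_sq\<close>, the first with \<open>v\<close> the image
  of \<open>w\<close>; the product terms cancel.\<close>

lemma norm_inversion_diff:
  assumes "y \<noteq> x" "w \<noteq> x"
  shows "norm (inversion x l y - inversion x l w) = l\<^sup>2 * norm (y - w) / (norm (y - x) * norm (w - x))"
proof -
  have "(norm (y - x))\<^sup>2 * (norm (inversion x l y - inversion x l w))\<^sup>2
      = l\<^sup>2 * (norm (inversion x l w - y))\<^sup>2 + ((norm (y - x))\<^sup>2 - l\<^sup>2) * ((l\<^sup>2 / norm (w - x))\<^sup>2 - l\<^sup>2)"
    using inversion_dist_sq[OF assms(1), of l "inversion x l w"]
    by (simp add: norm_inversion_center norm_minus_commute[of y "inversion x l w"])
  moreover have "(norm (w - x))\<^sup>2 * (norm (inversion x l w - y))\<^sup>2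
      = l\<^sup>2 * (norm (y - w))\<^sup>2 + ((norm (w - x))\<^sup>2 - l\<^sup>2) * ((norm (y - x))\<^sup>2 - l\<^sup>2)"
    using inversion_dist_sq[OF assms(2), of l y] by (simp add: norm_minus_commute)
  ultimately have "(norm (inversion x l y - inversion x l w))\<^sup>2
      = (l\<^sup>2 * norm (y - w) / (norm (y - x) * norm (w - x)))\<^sup>2"
    using assms by (simp add: field_simps)
  then show ?thesis
    by (metis norm_ge_zero zero_le_power2 mult_nonneg_nonneg divide_nonneg_nonneg power2_eq_imp_eq)
qed

lemma norm_inversion_swap:
  assumes "y \<noteq> x" "w \<noteq> x" "l \<noteq> 0"
  shows "norm (w - x) * norm (y - inversion x l w) = norm (y - x) * norm (inversion x l y - w)"
proof -
  have "inversion x l y \<noteq> x"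
    using norm_inversion_center[of x l y] assms by auto
  then have "norm (y - inversion x l w) = l\<^sup>2 * norm (inversion x l y - w) / (norm (inversion x l y - x) * norm (w - x))"
    using norm_inversion_diff[of "inversion x l y" x w l] assms by (simp add: inversion_inversion)
  then show ?thesis
    using assms by (simp add: norm_inversion_center field_simps)
qed

lemma inversion_image_annulus:
  fixes x :: "'a::real_inner"
  assumes "0 < l" "l < \<rho>"
  shows "inversion x l ` {w. l < norm (w - x) \<and> norm (w - x) < \<rho>}
    = {v. l\<^sup>2 / \<rho> < norm (v - x) \<and> norm (v - x) < l}" (is "_ ` ?A = ?B")
proof
  have *: "l\<^sup>2 / \<rho> < l\<^sup>2 / t \<and> l\<^sup>2 / t < l" if "l < t" "t < \<rho>" for t
    using that assms by (simp add: field_simps power2_eq_square)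
  show "inversion x l ` ?A \<subseteq> ?B"
    using * by (auto simp: norm_inversion_center)
  show "?B \<subseteq> inversion x l ` ?A"
  proof
    fix v assume v: "v \<in> ?B"
    have "0 < l\<^sup>2 / \<rho>" using assms by simp
    with v have pos: "0 < norm (v - x)" by auto
    then have "v = inversion x l (inversion x l v)" using assms by (simp add: inversion_inversion)
    moreover have "inversion x l v \<in> ?A"
      using v pos assms by (simp add: norm_inversion_center field_simps power2_eq_square)
    ultimately show "v \<in> inversion x l ` ?A" by blast
  qed
qed

section \<open>Jacobian of the inversion and change of variables\<close>

lemma inversion_has_derivative:
  assumes "w \<noteq> x"
  shows "(inversion x l has_derivative
    (\<lambda>e. (l\<^sup>2 / (norm (w - x))\<^sup>2) *\<^sub>R (e - (2 * ((w - x) \<bullet> e) / (norm (w - x))\<^sup>2) *\<^sub>R (w - x)))) (at w within S)"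
proof -
  have nz: "(w - x) \<bullet> (w - x) \<noteq> 0" using assms by simp
  have eq: "inversion x l = (\<lambda>y. x + (l\<^sup>2 / ((y - x) \<bullet> (y - x))) *\<^sub>R (y - x))"
    by (auto simp: inversion_def power2_norm_eq_inner)
  show ?thesis
    unfolding eq power2_norm_eq_inner
    apply (rule derivative_eq_intros refl nz)+
    using nz by (auto simp: fun_eq_iff scaleR_diff_right inner_commute field_simps power2_eq_square)
qed

text \<open>The derivative is \<open>(l / |w - x|)^2\<close> times the reflection in the hyperplane
  orthogonal to \<open>w - x\<close>. The reflection is orthogonal, so only the \<open>n\<close>-th
  power of the scale remains.\<close>

lemma abs_det_inversion:
  fixes w x :: "real^'n"
  assumes "w \<noteq> x"
  shows "\<bar>det (matrix (\<lambda>e. (l\<^sup>2 / (norm (w - x))\<^sup>2) *\<^sub>R (e - (2 * ((w - x) \<bullet> e) / (norm (w - x))\<^sup>2) *\<^sub>R (w - x))))\<bar>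
    = (l / norm (w - x)) ^ (2 * CARD('n))"
proof -
  define W where "W = w - x"
  define R where "R = (\<lambda>e. e - (2 * (W \<bullet> e) / (norm W)\<^sup>2) *\<^sub>R W)"
  define c where "c = l\<^sup>2 / (norm W)\<^sup>2"
  have nz: "W \<bullet> W \<noteq> 0" using assms by (simp add: W_def)
  have lin: "linear R"
    unfolding R_def
    by (rule linearI) (simp_all add: algebra_simps add_divide_distrib)
  have "R e \<bullet> R e' = e \<bullet> e'" for e e'
    using nz by (simp add: R_def power2_norm_eq_inner inner_diff_left inner_diff_right inner_commute field_simps)
  with lin have orth: "orthogonal_transformation R"
    by (simp add: orthogonal_transformation_def)
  have "matrix ((*\<^sub>R) c \<circ> R) = matrix ((*\<^sub>R) c) ** matrix R"
    by (rule matrix_compose[OF lin]) (rule linear_scaleR)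
  then have "\<bar>det (matrix ((*\<^sub>R) c \<circ> R))\<bar> = \<bar>c ^ CARD('n)\<bar>"
    using orthogonal_transformation_det[OF orth] by (simp add: det_mul abs_mult)
  also have "\<dots> = (l / norm W) ^ (2 * CARD('n))"
    by (simp add: c_def power_mult power_divide)
  finally show ?thesis
    by (simp add: comp_def R_def c_def W_def)
qed

text \<open>The change-of-variables theorem of the library needs a well-ordered index type.\<close>

typedef 'a ordered_copy = "UNIV :: 'a set" ..

instance ordered_copy :: (finite) finite
proof
  have "(UNIV :: 'a ordered_copy set) = Abs_ordered_copy ` UNIV"
    by (metis Rep_ordered_copy_inverse UNIV_eq_I rangeI)
  then show "finite (UNIV :: 'a ordered_copy set)"
    by (metis finite finite_imageI)
qed

instantiation ordered_copy :: (finite) wellorder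
begin

definition less_eq_ordered_copy :: "'a ordered_copy \<Rightarrow> 'a ordered_copy \<Rightarrow> bool" where
  "x \<le> y \<longleftrightarrow> to_nat (Rep_ordered_copy x) \<le> to_nat (Rep_ordered_copy y)"

definition less_ordered_copy :: "'a ordered_copy \<Rightarrow> 'a ordered_copy \<Rightarrow> bool" where
  "x < y \<longleftrightarrow> to_nat (Rep_ordered_copy x) < to_nat (Rep_ordered_copy y)"

instance
proof
  fix P :: "'a ordered_copy \<Rightarrow> bool" and b
  assume step: "\<And>x. (\<And>y. y < x \<Longrightarrow> P y) \<Longrightarrow> P x"
  show "P b"
    by (induction b rule: measure_induct[where f = "\<lambda>x. to_nat (Rep_ordered_copy x)"])
      (use step less_ordered_copy_def in blast)
qed (auto simp: less_eq_ordered_copy_def less_ordered_copy_def Rep_ordered_copy_inject)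

end

definition to_ordered :: "real^'n \<Rightarrow> real^'n ordered_copy" where
  "to_ordered v = (\<chi> i. v $ Rep_ordered_copy i)"

lemma bij_Rep_ordered_copy: "bij Rep_ordered_copy"
  by (metis Abs_ordered_copy_inverse Rep_ordered_copy_inject UNIV_I bijI injI surj_def)

lemma card_ordered_copy: "CARD('n::finite ordered_copy) = CARD('n)"
  using bij_betw_same_card[OF bij_Rep_ordered_copy] .

lemma to_ordered_surj: "\<exists>v. w = to_ordered v"
proof
  show "w = to_ordered (\<chi> i. w $ Abs_ordered_copy i)"
    by (simp add: to_ordered_def vec_eq_iff Rep_ordered_copy_inverse)
qed

lemma linear_to_ordered: "linear to_ordered"
  by (rule linearI) (simp_all add: to_ordered_def vec_eq_iff)

lemma norm_to_ordered: "norm (to_ordered v) = norm (v :: real^'n)"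
proof -
  have "(\<Sum>i\<in>UNIV. (v $ Rep_ordered_copy i)\<^sup>2) = (\<Sum>i\<in>UNIV. (v $ i)\<^sup>2)"
    by (rule sum.reindex_bij_betw[OF bij_Rep_ordered_copy])
  then show ?thesis
    by (simp add: norm_vec_def L2_set_def to_ordered_def)
qed

lemma to_ordered_inversion:
  "to_ordered (inversion x l y) = inversion (to_ordered x) l (to_ordered y)"
  by (simp add: inversion_def linear_add[OF linear_to_ordered] linear_diff[OF linear_to_ordered, symmetric]
      linear_cmul[OF linear_to_ordered] norm_to_ordered)

lemma measurable_to_ordered[measurable]: "to_ordered \<in> borel_measurable borel"
  by (intro borel_measurable_continuous_onI linear_continuous_on linear_to_ordered
      linear_conv_bounded_linear[THEN iffD1])

text \<open>Renaming coordinates takes boxes to boxes with the same side lengths, and Lebesgue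
  measure is determined by its values on boxes.\<close>

lemma distr_to_ordered: "lborel = distr lborel borel (to_ordered :: real^'n \<Rightarrow> _)"
proof (rule lborel_eqI)
  fix l u :: "real^'n ordered_copy"
  assume lu: "\<And>b. b \<in> Basis \<Longrightarrow> l \<bullet> b \<le> u \<bullet> b"
  obtain l' u' where l': "l = to_ordered l'" and u': "u = to_ordered u'"
    using to_ordered_surj by blast
  have le: "l $ i \<le> u $ i" for i
    using lu[of "axis i 1"] by (simp add: inner_axis)
  have le': "l' $ i \<le> u' $ i" for i
    using le[of "Abs_ordered_copy i"] by (simp add: l' u' to_ordered_def Abs_ordered_copy_inverse)
  have vim: "to_ordered -` box l u \<inter> space lborel = box l' u'"
  proof -
    have all: "(\<forall>i. P (Rep_ordered_copy i)) \<longleftrightarrow> (\<forall>i. P i)" for P :: "'n \<Rightarrow> bool"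
      by (metis Abs_ordered_copy_inverse UNIV_I)
    show ?thesis
      using all[of "\<lambda>i. l' $ i < v $ i \<and> v $ i < u' $ i" for v]
      by (simp add: set_eq_iff mem_box_cart l' u' to_ordered_def)
  qed
  have prodB: "(\<Prod>b\<in>Basis. (b'-a') \<bullet> b) = (\<Prod>i\<in>UNIV. b' $ i - a' $ i)" for a' b' :: "real^'m"
    by (simp add: Basis_vec_def prod.UNION_disjoint axis_eq_axis inner_axis inner_diff_left)
  have "emeasure (distr lborel borel to_ordered) (box l u) = emeasure lborel (box l' u')"
    unfolding vim[symmetric] by (rule emeasure_distr) (simp_all add: borel_open)
  also have "\<dots> = (\<Prod>b\<in>Basis. (u' - l') \<bullet> b)"
    using le' by (intro emeasure_lborel_box) (auto simp: Basis_vec_def inner_axis)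
  also have "(\<Prod>b\<in>Basis. (u' - l') \<bullet> b) = (\<Prod>i\<in>UNIV. u' $ i - l' $ i)" by (rule prodB)
  also have "\<dots> = (\<Prod>i\<in>UNIV. u $ i - l $ i)"
    using prod.reindex_bij_betw[OF bij_Rep_ordered_copy, of "\<lambda>i. u' $ i - l' $ i"]
    by (simp add: l' u' to_ordered_def)
  also have "\<dots> = (\<Prod>b\<in>Basis. (u - l) \<bullet> b)" by (rule prodB[symmetric])
  finally show "emeasure (distr lborel borel to_ordered) (box l u) = ennreal (\<Prod>b\<in>Basis. (u - l) \<bullet> b)" .
qed simp

text \<open>The inversion is its own inverse and swaps the two annuli, so it serves as both maps in
  \<open>cov_invertible_real\<close>. The annuli stay away from \<open>x\<close>, where it is not
  smooth.\<close>

lemma inversion_change_of_variables_ordered: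
  fixes x :: "real^'n::{finite,wellorder}" and f :: "real^'n::_ \<Rightarrow> real"
  assumes l: "0 < l" "l < \<rho>"
    and f: "f \<in> borel_measurable borel"
  defines "S \<equiv> {w. l < norm (w - x) \<and> norm (w - x) < \<rho>}"
    and "S' \<equiv> {v. l\<^sup>2 / \<rho> < norm (v - x) \<and> norm (v - x) < l}"
  assumes int: "set_integrable lborel S' f"
  shows "set_integrable lborel S (\<lambda>w. (l / norm (w - x)) ^ (2 * CARD('n)) * f (inversion x l w))"
    "(LINT w:S|lborel. (l / norm (w - x)) ^ (2 * CARD('n)) * f (inversion x l w)) = (LINT v:S'|lborel. f v)"
proof -
  let ?D = "\<lambda>w e. (l\<^sup>2 / (norm (w - x))\<^sup>2) *\<^sub>R (e - (2 * ((w - x) \<bullet> e) / (norm (w - x))\<^sup>2) *\<^sub>R (w - x))"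
  let ?g = "\<lambda>w. (l / norm (w - x)) ^ (2 * CARD('n)) * f (inversion x l w)"
  have S[measurable]: "S \<in> sets borel" "S' \<in> sets borel"
    unfolding S_def S'_def by measurable
  have inv[measurable]: "inversion x l \<in> borel_measurable borel"
    unfolding inversion_def by measurable
  note f[measurable]
  have [measurable]: "?g \<in> borel_measurable borel" by measurable
  have img: "inversion x l ` S = S'"
    unfolding S_def S'_def by (rule inversion_image_annulus[OF l])
  have ne: "w \<noteq> x" if "w \<in> S" for w using that l by (auto simp: S_def)
  have leb: "set_integrable lebesgue T g \<longleftrightarrow> set_integrable lborel T g"
      "(LINT v:T|lebesgue. g v) = (LINT v:T|lborel. g v)"
    if [measurable]: "T \<in> sets borel" "g \<in> borel_measurable borel" for T and g :: "real^'n::_ \<Rightarrow> real"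
    unfolding set_integrable_def set_lebesgue_integral_def
    by (auto intro!: integrable_completion integral_completion)
  have ne': "w \<noteq> x" if "w \<in> S'" for w
  proof -
    have "0 < l\<^sup>2 / \<rho>" using l by simp
    then show ?thesis using that by (auto simp: S'_def)
  qed
  have inv: "inversion x l v \<in> S \<and> inversion x l (inversion x l v) = v" if v: "v \<in> S'" for v
  proof -
    obtain w where "w \<in> S" "v = inversion x l w" using v img by blast
    then show ?thesis using ne inversion_inversion[of w x l] l by auto
  qed
  have "(\<lambda>w. \<bar>det (matrix (?D w))\<bar> * f (inversion x l w)) absolutely_integrable_on S \<and>
      integral S (\<lambda>w. \<bar>det (matrix (?D w))\<bar> * f (inversion x l w)) = integral S' f \<longleftrightarrow>
      f absolutely_integrable_on S' \<and> integral S' f = integral S' f"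
  proof (rule cov_invertible_real)
    show "(inversion x l has_derivative ?D w) (at w within S)" if "w \<in> S" for w
      by (rule inversion_has_derivative[OF ne[OF that]])
    show "(inversion x l has_derivative ?D w) (at w within S')" if "w \<in> S'" for w
      by (rule inversion_has_derivative[OF ne'[OF that]])
    show "inversion x l w \<in> S' \<and> inversion x l (inversion x l w) = w" if "w \<in> S" for w
      using that img ne inversion_inversion[of w x l] l by auto
    show "inversion x l v \<in> S \<and> inversion x l (inversion x l v) = v" if "v \<in> S'" for v
      using inv[OF that] .
    \<comment> \<open>The image of \<open>v\<close> lies on the same ray from \<open>x\<close>, so
      both derivatives use the same reflection, with scales \<open>c\<close> and
      \<open>1 / c\<close>.\<close>
    show "?D v \<circ> ?D (inversion x l v) = id" if "v \<in> S'" for v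
    proof
      fix e
      define V where "V = v - x"
      define c where "c = l\<^sup>2 / (norm V)\<^sup>2"
      have nz: "V \<bullet> V \<noteq> 0" using ne'[OF that] by (simp add: V_def)
      then have c: "c \<noteq> 0" using l by (simp add: c_def)
      have iv: "inversion x l v - x = c *\<^sub>R V" by (simp add: inversion_def V_def c_def)
      have c': "l\<^sup>2 / (norm (c *\<^sub>R V))\<^sup>2 = 1 / c"
        using nz l by (simp add: c_def power2_eq_square field_simps power2_norm_eq_inner[unfolded power2_eq_square])
      define k where "k = 2 * (V \<bullet> e) / (norm V)\<^sup>2"
      have k: "(2 * (c *\<^sub>R V \<bullet> e) / (norm (c *\<^sub>R V))\<^sup>2) *\<^sub>R c *\<^sub>R V = k *\<^sub>R V"
        using c nz by (simp add: k_def power2_norm_eq_inner field_simps power2_eq_square)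
      define e' where "e' = (1 / c) *\<^sub>R (e - k *\<^sub>R V)"
      have De: "?D (inversion x l v) e = e'"
        unfolding iv c' k e'_def ..
      have "2 * (V \<bullet> e') / (norm V)\<^sup>2 = - k / c"
        using nz c by (simp add: e'_def k_def inner_diff_right power2_norm_eq_inner field_simps)
      then have "?D v e' = c *\<^sub>R (e' - (- k / c) *\<^sub>R V)"
        by (simp only: V_def[symmetric] c_def[symmetric])
      also have "\<dots> = e"
        using c by (simp add: e'_def scaleR_right_distrib scaleR_right_diff_distrib)
      finally show "(?D v \<circ> ?D (inversion x l v)) e = id e"
        unfolding comp_def De by simp
    qed
  qed
  moreover have "f absolutely_integrable_on S'"
    using int by (simp add: leb)
  ultimately have 1: "(\<lambda>w. \<bar>det (matrix (?D w))\<bar> * f (inversion x l w)) absolutely_integrable_on S"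
      "integral S (\<lambda>w. \<bar>det (matrix (?D w))\<bar> * f (inversion x l w)) = integral S' f"
    by auto
  have eq: "\<bar>det (matrix (?D w))\<bar> * f (inversion x l w) = ?g w" if "w \<in> S" for w
    using abs_det_inversion[OF ne[OF that]] by simp
  have 2: "?g absolutely_integrable_on S"
    using 1(1) eq by (simp cong: set_integrable_cong)
  moreover have "integral S ?g = integral S' f"
    unfolding 1(2)[symmetric] by (rule Henstock_Kurzweil_Integration.integral_cong) (rule eq[symmetric])
  ultimately have 3: "(LINT w:S|lebesgue. ?g w) = (LINT v:S'|lebesgue. f v)"
    using \<open>f absolutely_integrable_on S'\<close> by (simp add: set_lebesgue_integral_eq_integral)
  show "set_integrable lborel S ?g" using 2 by (subst leb(1)[symmetric]) auto
  show "(LINT w:S|lborel. ?g w) = (LINT v:S'|lborel. f v)"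
    using 3 by (simp add: leb)
qed

lemma inversion_change_of_variables:
  fixes x :: "real^'n" and f :: "real^'n \<Rightarrow> real"
  assumes l: "0 < l" "l < \<rho>"
    and f: "f \<in> borel_measurable borel"
  defines "S \<equiv> {w. l < norm (w - x) \<and> norm (w - x) < \<rho>}"
    and "S' \<equiv> {v. l\<^sup>2 / \<rho> < norm (v - x) \<and> norm (v - x) < l}"
  assumes int: "set_integrable lborel S' f"
  shows "set_integrable lborel S (\<lambda>w. (l / norm (w - x)) ^ (2 * CARD('n)) * f (inversion x l w))"
    "(LINT w:S|lborel. (l / norm (w - x)) ^ (2 * CARD('n)) * f (inversion x l w)) = (LINT v:S'|lborel. f v)"
proof -
  define from_ordered :: "real^'n ordered_copy \<Rightarrow> real^'n" where
    "from_ordered w = (\<chi> i. w $ Abs_ordered_copy i)" for w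
  have ft: "from_ordered (to_ordered v) = v" for v
    by (simp add: from_ordered_def to_ordered_def vec_eq_iff Abs_ordered_copy_inverse)
  have [measurable]: "from_ordered \<in> borel_measurable borel"
    unfolding from_ordered_def
    by (intro borel_measurable_continuous_onI continuous_on_vec_lambda continuous_intros)
  note f[measurable]
  let ?x = "to_ordered x"
  let ?f = "\<lambda>w. f (from_ordered w)"
  let ?T = "{w. l < norm (w - ?x) \<and> norm (w - ?x) < \<rho>}"
  let ?T' = "{v. l\<^sup>2 / \<rho> < norm (v - ?x) \<and> norm (v - ?x) < l}"
  have [measurable]: "inversion ?x l \<in> borel_measurable borel"
    unfolding inversion_def by measurable
  \<comment> \<open>Sets described by the distance to the centre are carried along by the isometry
    \<open>to_ordered\<close>; both annuli have this form.\<close>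
  have tr: "set_integrable lborel {w. P (norm (w - ?x))} g \<longleftrightarrow> set_integrable lborel {w. P (norm (w - x))} (\<lambda>w. g (to_ordered w))"
      "(LINT w:{w. P (norm (w - ?x))}|lborel. g w) = (LINT w:{w. P (norm (w - x))}|lborel. g (to_ordered w))"
    if [measurable]: "g \<in> borel_measurable borel" "Measurable.pred borel P" for P and g :: "_ \<Rightarrow> real"
  proof -
    let ?h = "\<lambda>w. indicat_real {w. P (norm (w - ?x))} w *\<^sub>R g w"
    have [measurable]: "?h \<in> borel_measurable borel" by measurable
    have eq: "?h (to_ordered w) = indicat_real {w. P (norm (w - x))} w *\<^sub>R g (to_ordered w)" for w
      by (simp add: indicator_def linear_diff[OF linear_to_ordered, symmetric] norm_to_ordered)
    have "integrable lborel ?h = integrable (distr lborel borel (to_ordered :: real^'n \<Rightarrow> _)) ?h"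
      by (simp flip: distr_to_ordered)
    also have "\<dots> = integrable lborel (\<lambda>w. ?h (to_ordered w))"
      by (rule integrable_distr_eq) simp_all
    finally show "set_integrable lborel {w. P (norm (w - ?x))} g \<longleftrightarrow> set_integrable lborel {w. P (norm (w - x))} (\<lambda>w. g (to_ordered w))"
      unfolding set_integrable_def eq .
    have "integral\<^sup>L lborel ?h = integral\<^sup>L (distr lborel borel (to_ordered :: real^'n \<Rightarrow> _)) ?h"
      by (simp flip: distr_to_ordered)
    also have "\<dots> = integral\<^sup>L lborel (\<lambda>w. ?h (to_ordered w))"
      by (rule integral_distr) simp_all
    finally show "(LINT w:{w. P (norm (w - ?x))}|lborel. g w) = (LINT w:{w. P (norm (w - x))}|lborel. g (to_ordered w))"
      unfolding set_lebesgue_integral_def eq .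
  qed
  let ?G = "\<lambda>w. (l / norm (w - ?x)) ^ (2 * CARD('n)) * ?f (inversion ?x l w)"
  have G: "?G (to_ordered w) = (l / norm (w - x)) ^ (2 * CARD('n)) * f (inversion x l w)" for w
    by (simp add: to_ordered_inversion[symmetric] ft linear_diff[OF linear_to_ordered, symmetric] norm_to_ordered)
  have "set_integrable lborel ?T' ?f"
    using int by (subst tr(1)) (simp_all add: ft S'_def)
  note 1 = inversion_change_of_variables_ordered[OF l _ this, unfolded card_ordered_copy]
  have "set_integrable lborel ?T ?G" by (rule 1) simp
  then show "set_integrable lborel S (\<lambda>w. (l / norm (w - x)) ^ (2 * CARD('n)) * f (inversion x l w))"
    unfolding S_def by (subst (asm) tr(1)) (simp_all only: G, simp_all)
  have "(LINT w:?T|lborel. ?G w) = (LINT v:?T'|lborel. ?f v)" by (rule 1) simp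
  then show "(LINT w:S|lborel. (l / norm (w - x)) ^ (2 * CARD('n)) * f (inversion x l w)) = (LINT v:S'|lborel. f v)"
    unfolding S_def S'_def by (subst (asm) (1 2) tr(2)) (simp_all only: G ft, simp_all)
qed

section \<open>Riesz potentials and the Kelvin kernel\<close>

lemma lebesgue_borel_set_integral:
  fixes f :: "'a::euclidean_space \<Rightarrow> real"
  assumes "set_borel_measurable borel S f"
  shows "set_integrable lebesgue S f \<longleftrightarrow> set_integrable lborel S f"
    "(LINT v:S|lebesgue. f v) = (LINT v:S|lborel. f v)"
  using assms unfolding set_integrable_def set_lebesgue_integral_def set_borel_measurable_def
  by (auto intro!: integrable_completion integral_completion)

lemma inversion_change_of_variables_lebesgue:
  fixes x :: "real^'n" and f :: "real^'n \<Rightarrow> real"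
  assumes l: "0 < l" "l < \<rho>"
  defines "S \<equiv> {w. l < norm (w - x) \<and> norm (w - x) < \<rho>}"
    and "S' \<equiv> {v. l\<^sup>2 / \<rho> < norm (v - x) \<and> norm (v - x) < l}"
  assumes f: "set_borel_measurable borel S' f" and int: "set_integrable lebesgue S' f"
  shows "set_integrable lebesgue S (\<lambda>w. (l / norm (w - x)) ^ (2 * CARD('n)) * f (inversion x l w))"
    "(LINT w:S|lebesgue. (l / norm (w - x)) ^ (2 * CARD('n)) * f (inversion x l w)) = (LINT v:S'|lebesgue. f v)"
proof -
  define f' where "f' = (\<lambda>v. indicat_real S' v * f v)"
  have f'[measurable]: "f' \<in> borel_measurable borel"
    using f by (simp add: f'_def set_borel_measurable_def)
  have [measurable]: "inversion x l \<in> borel_measurable borel"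
    unfolding inversion_def by measurable
  have S[measurable]: "S \<in> sets borel" "S' \<in> sets borel"
    unfolding S_def S'_def by measurable
  have img: "inversion x l ` S = S'"
    unfolding S_def S'_def by (rule inversion_image_annulus[OF l])
  let ?g = "\<lambda>f w. (l / norm (w - x)) ^ (2 * CARD('n)) * f (inversion x l w)"
  have eq: "?g f w = ?g f' w" if "w \<in> S" for w
    using that img by (auto simp: f'_def)
  have eq': "f v = f' v" if "v \<in> S'" for v
    using that by (simp add: f'_def)
  have "set_integrable lborel S' f'"
    using int eq' by (subst lebesgue_borel_set_integral(1)[symmetric])
      (auto simp: set_borel_measurable_def cong: set_integrable_cong)
  note 1 = inversion_change_of_variables[OF l f' this[unfolded S'_def], folded S_def S'_def]
  have m: "set_borel_measurable borel S (?g f')"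
    unfolding set_borel_measurable_def by measurable
  have "set_integrable lebesgue S (?g f')"
    using 1(1) by (subst lebesgue_borel_set_integral(1)[OF m])
  then show "set_integrable lebesgue S (?g f)"
    by (subst set_integrable_cong[OF refl refl eq])
  have "(LINT w:S|lebesgue. ?g f w) = (LINT w:S|lebesgue. ?g f' w)"
    by (rule set_lebesgue_integral_cong) (use eq in auto)
  also have "\<dots> = (LINT w:S|lborel. ?g f' w)" by (rule lebesgue_borel_set_integral(2)[OF m])
  also have "\<dots> = (LINT v:S'|lborel. f' v)" by (rule 1(2))
  also have "\<dots> = (LINT v:S'|lebesgue. f' v)"
    by (rule lebesgue_borel_set_integral(2)[symmetric]) (simp add: set_borel_measurable_def)
  also have "\<dots> = (LINT v:S'|lebesgue. f v)"
    by (rule set_lebesgue_integral_cong) (use eq' in auto)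
  finally show "(LINT w:S|lebesgue. ?g f w) = (LINT v:S'|lebesgue. f v)" .
qed

section \<open>Riesz potentials of small sets\<close>

text \<open>Dyadic decomposition: on the shell where \<open>|y - w|\<close> is between
  \<open>r / 2^(k+1)\<close> and \<open>r / 2^k\<close> the kernel is at most \<open>c k\<close>.
  Bounding each shell by its full ball gives a geometric series with ratio
  \<open>2 powr (a - n) < 1\<close>.\<close>

lemma nn_integral_riesz_ball:
  fixes a :: real
  assumes "0 < a" "a < DIM('a::euclidean_space)"
  shows "\<exists>C\<ge>0. \<forall>r>0. \<forall>y::'a. (\<integral>\<^sup>+ w. ennreal (norm (y - w) powr (- a)) * indicator (ball y r) w \<partial>lborel)
           \<le> ennreal (C * r powr (DIM('a) - a))"
proof -
  define n where "n = DIM('a)"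
  define q :: real where "q = 2 powr (a - n)"
  have q: "0 < q" "q < 1"
    using assms powr_less_mono[of "a - n" 0 2] by (auto simp: q_def n_def)
  define V where "V = unit_ball_vol n"
  define C where "C = 2 powr a * V / (1 - q)"
  have "(\<integral>\<^sup>+ w. ennreal (norm (y - w) powr (- a)) * indicator (ball y r) w \<partial>lborel)
           \<le> ennreal (C * r powr (n - a))" if r: "r > 0" for r and y :: 'a
  proof -
    have [measurable]: "ball y s \<in> sets borel" for s :: real
      by (rule borel_open) simp
    define c where "c k = (r / 2 ^ Suc k) powr (- a)" for k
    have le: "ennreal (norm (y - w) powr (- a)) * indicator (ball y r) w
      \<le> (\<Sum>k. ennreal (c k) * indicator (ball y (r / 2 ^ k)) w)" for w
    proof (cases "w \<in> ball y r \<and> w \<noteq> y")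
      case True
      define t where "t = norm (y - w)"
      have t: "0 < t" "t < r" using True by (auto simp: t_def dist_norm)
      obtain k where "(1 / 2 :: real) ^ k < t / r"
        using real_arch_pow_inv[of "t / r" "1 / 2"] t r by auto
      then have "r / 2 ^ k < t" using r by (simp add: field_simps power_one_over)
      moreover have "r / 2 ^ Suc k \<le> r / 2 ^ k" using r by (simp add: field_simps)
      ultimately have ex: "r / 2 ^ Suc k \<le> t" by linarith
      \<comment> \<open>The least index puts \<open>t\<close> into exactly the shell number
        \<open>j\<close>: its predecessor fails, which is the upper bound on
        \<open>t\<close>.\<close>
      define j where "j = (LEAST k. r / 2 ^ Suc k \<le> t)"
      have j: "r / 2 ^ Suc j \<le> t" unfolding j_def by (rule LeastI[of _ k]) (rule ex)
      have j': "t < r / 2 ^ j"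
      proof (cases j)
        case (Suc i)
        then have "\<not> r / 2 ^ Suc i \<le> t" using not_less_Least[of i "\<lambda>k. r / 2 ^ Suc k \<le> t"] by (simp add: j_def)
        then show ?thesis using Suc by simp
      qed (use t in simp)
      have "t powr (- a) \<le> c j"
        unfolding c_def using j r assms t by (intro powr_mono2') auto
      then have "ennreal (norm (y - w) powr (- a)) * indicator (ball y r) w
        \<le> ennreal (c j) * indicator (ball y (r / 2 ^ j)) w"
        using j' True by (auto simp: t_def dist_norm indicator_def intro: ennreal_leI)
      also have "\<dots> \<le> (\<Sum>k. ennreal (c k) * indicator (ball y (r / 2 ^ k)) w)"
        using sum_le_suminf[of "\<lambda>k. ennreal (c k) * indicator (ball y (r / 2 ^ k)) w" "{j}"]
        by (simp del: sum_mult_indicator)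
      finally show ?thesis .
    qed (auto simp: indicator_def)
    have "(\<integral>\<^sup>+ w. ennreal (norm (y - w) powr (- a)) * indicator (ball y r) w \<partial>lborel)
      \<le> (\<integral>\<^sup>+ w. (\<Sum>k. ennreal (c k) * indicator (ball y (r / 2 ^ k)) w) \<partial>lborel)"
      by (rule nn_integral_mono) (rule le)
    also have "\<dots> = (\<Sum>k. \<integral>\<^sup>+ w. ennreal (c k) * indicator (ball y (r / 2 ^ k)) w \<partial>lborel)"
      by (rule nn_integral_suminf) measurable
    also have "\<dots> = (\<Sum>k. ennreal (2 powr a * V * r powr (n - a) * q ^ k))"
    proof (rule suminf_cong)
      fix k
      have "(\<integral>\<^sup>+ w. ennreal (c k) * indicator (ball y (r / 2 ^ k)) w \<partial>lborel)
        = ennreal (c k) * ennreal (V * (r / 2 ^ k) ^ n)"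
        using r by (simp add: nn_integral_cmult_indicator emeasure_ball V_def n_def)
      also have "\<dots> = ennreal (c k * (V * (r / 2 ^ k) ^ n))"
        by (rule ennreal_mult[symmetric]) (use r in \<open>auto simp: c_def V_def\<close>)
      also have "c k * (V * (r / 2 ^ k) ^ n) = 2 powr a * V * r powr (n - a) * q ^ k"
      proof -
        have "r / 2 ^ Suc k = r * 2 powr (- (real k + 1))"
          unfolding powr_minus_divide powr_add powr_realpow[OF zero_less_numeral] by simp
        then have c: "c k = r powr (- a) * 2 powr (a * (real k + 1))"
          using r by (simp add: c_def powr_mult powr_powr algebra_simps)
        have "r / 2 ^ k = r * 2 powr (- real k)"
          unfolding powr_minus_divide powr_realpow[OF zero_less_numeral] by simp
        then have "(r / 2 ^ k) ^ n = (r * 2 powr (- real k)) powr n"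
          using r by (simp add: powr_realpow)
        also have "\<dots> = r powr n * 2 powr (- (real k * n))"
          using r by (simp add: powr_mult powr_powr)
        finally have d: "(r / 2 ^ k) ^ n = r powr n * 2 powr (- (real k * n))" .
        have q: "q ^ k = 2 powr ((a - n) * k)"
          using powr_realpow[of "2 powr (a - n)" k] by (simp add: q_def powr_powr)
        have "2 powr (a * (real k + 1)) * 2 powr (- (real k * n)) = 2 powr a * 2 powr ((a - n) * real k)"
          by (simp add: algebra_simps flip: powr_add)
        moreover have "r powr (n - a) = r powr n * r powr (- a)"
          by (simp flip: powr_add)
        ultimately show ?thesis unfolding c d q by simp
      qed
      finally show "(\<integral>\<^sup>+ w. ennreal (c k) * indicator (ball y (r / 2 ^ k)) w \<partial>lborel)
        = ennreal (2 powr a * V * r powr (n - a) * q ^ k)" .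
    qed
    also have "\<dots> = ennreal (\<Sum>k. 2 powr a * V * r powr (n - a) * q ^ k)"
      using q by (intro suminf_ennreal2) (auto simp: V_def intro!: summable_mult summable_geometric)
    also have "(\<Sum>k. 2 powr a * V * r powr (n - a) * q ^ k) = C * r powr (n - a)"
      using q by (simp add: suminf_mult summable_geometric suminf_geometric C_def)
    finally show ?thesis .
  qed
  moreover have "C \<ge> 0" using q by (simp add: C_def V_def)
  ultimately show ?thesis unfolding n_def by blast
qed

text \<open>Split at distance \<open>s\<close> from \<open>y\<close>: the near part is at most
  \<open>C * s powr (n - a)\<close>, the far part at most \<open>s powr (- a)\<close> times the
  measure of \<open>G\<close>. Neither bound depends on \<open>y\<close> or on the shape of
  \<open>G\<close>.\<close>

lemma riesz_potential_small:
  fixes a :: real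
  assumes a: "0 < a" "a < DIM('a::euclidean_space)" and e: "0 < e"
  shows "\<exists>\<delta>>0. \<forall>G\<in>sets borel. emeasure lborel G \<le> ennreal \<delta> \<longrightarrow>
    (\<forall>y::'a. set_integrable lebesgue G (\<lambda>w. norm (y - w) powr (- a)) \<and>
       (LINT w:G|lebesgue. norm (y - w) powr (- a)) \<le> e)"
proof -
  define n where "n = DIM('a)"
  obtain C where C: "C \<ge> 0" and all: "\<forall>r>0. \<forall>y::'a.
      (\<integral>\<^sup>+ w. ennreal (norm (y - w) powr (- a)) * indicator (ball y r) w \<partial>lborel) \<le> ennreal (C * r powr (n - a))"
    using nn_integral_riesz_ball[OF a] unfolding n_def by (elim exE conjE)
  note Cb = all[rule_format]
  \<comment> \<open>\<open>s\<close> makes the near part at most \<open>e / 2\<close>, and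
    \<open>\<delta>\<close> below does the same for the far part. \<open>C + 1\<close> avoids
    division by a possible \<open>C = 0\<close>.\<close>
  define s where "s = (e / (2 * (C + 1))) powr (1 / (n - a))"
  have s: "s > 0" using e C by (simp add: s_def)
  have sn: "s powr (n - a) = e / (2 * (C + 1))"
    using e C a by (simp add: s_def powr_powr n_def)
  define D where "D = C + 1"
  have "C * s powr (n - a) \<le> D * (e / (2 * D))"
    using e C sn unfolding D_def by (simp only:) (rule mult_right_mono, simp_all)
  also have "\<dots> = e / 2" using C by (simp add: D_def[symmetric]) (simp add: D_def)
  finally have Cs: "C * s powr (n - a) \<le> e / 2" .
  have [measurable]: "ball y s \<in> sets borel" for y :: 'a
    by (rule borel_open) simp
  define \<delta> where "\<delta> = e / 2 * s powr a"
  have "\<delta> > 0" using e s by (simp add: \<delta>_def)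
  moreover have "set_integrable lebesgue G (\<lambda>w. norm (y - w) powr (- a)) \<and>
       (LINT w:G|lebesgue. norm (y - w) powr (- a)) \<le> e"
    if G[measurable]: "G \<in> sets borel" and Gd: "emeasure lborel G \<le> ennreal \<delta>" for G and y :: 'a
  proof -
    have "(\<integral>\<^sup>+ w. ennreal (indicator G w *\<^sub>R norm (y - w) powr (- a)) \<partial>lborel)
      \<le> (\<integral>\<^sup>+ w. ennreal (norm (y - w) powr (- a)) * indicator (ball y s) w + ennreal (s powr (- a)) * indicator G w \<partial>lborel)"
    proof (rule nn_integral_mono)
      fix w
      have "norm (y - w) powr (- a) \<le> s powr (- a)" if "w \<notin> ball y s"
        using that a s by (intro powr_mono2') (auto simp: dist_norm)
      then show "ennreal (indicator G w *\<^sub>R norm (y - w) powr (- a))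
        \<le> ennreal (norm (y - w) powr (- a)) * indicator (ball y s) w + ennreal (s powr (- a)) * indicator G w"
        by (auto simp: indicator_def intro: ennreal_leI)
    qed
    also have "\<dots> = (\<integral>\<^sup>+ w. ennreal (norm (y - w) powr (- a)) * indicator (ball y s) w \<partial>lborel)
        + ennreal (s powr (- a)) * emeasure lborel G"
      by (subst nn_integral_add) (simp_all add: nn_integral_cmult_indicator)
    also have "\<dots> \<le> ennreal (C * s powr (n - a)) + ennreal (s powr (- a)) * ennreal \<delta>"
      using Cb[OF s] Gd by (intro add_mono mult_left_mono) auto
    also have "\<dots> = ennreal (C * s powr (n - a) + s powr (- a) * \<delta>)"
      using C \<open>\<delta> > 0\<close> by (simp add: ennreal_mult ennreal_plus)
    also have "\<dots> \<le> ennreal e"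
    proof (rule ennreal_leI)
      have "s powr (- a) * \<delta> = e / 2"
        using s by (simp add: \<delta>_def powr_minus)
      then show "C * s powr (n - a) + s powr (- a) * \<delta> \<le> e" using Cs by simp
    qed
    finally have le: "(\<integral>\<^sup>+ w. ennreal (indicator G w *\<^sub>R norm (y - w) powr (- a)) \<partial>lborel) \<le> ennreal e" .
    have int: "integrable lborel (\<lambda>w. indicator G w *\<^sub>R norm (y - w) powr (- a))"
    proof (rule integrableI_nonneg)
      show "(\<integral>\<^sup>+ w. ennreal (indicator G w *\<^sub>R norm (y - w) powr (- a)) \<partial>lborel) < \<infinity>"
        using le_less_trans[OF le ennreal_less_top] by simp
    qed auto
    moreover have "integral\<^sup>L lborel (\<lambda>w. indicator G w *\<^sub>R norm (y - w) powr (- a)) \<le> e"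
    proof -
      have "ennreal (integral\<^sup>L lborel (\<lambda>w. indicator G w *\<^sub>R norm (y - w) powr (- a))) \<le> ennreal e"
        using le by (subst nn_integral_eq_integral[OF int, symmetric]) auto
      then show ?thesis using e by simp
    qed
    moreover have m: "set_borel_measurable borel G (\<lambda>w. norm (y - w) powr (- a))"
      unfolding set_borel_measurable_def by measurable
    ultimately show ?thesis
      unfolding lebesgue_borel_set_integral[OF m] by (simp add: set_integrable_def set_lebesgue_integral_def)
  qed
  ultimately show ?thesis by blast
qed

section \<open>The kernel of the difference between a solution and its Kelvin transform\<close>

text \<open>Subtracting from the integral equation at \<open>y\<close> its copy at the reflected
  point, weighted by \<open>(l / |y - x|) powr a\<close>, leaves \<open>u powr p\<close> integrated
  against this kernel.\<close>

definition kelvin_kernel :: "real \<Rightarrow> 'a::real_inner \<Rightarrow> real \<Rightarrow> 'a \<Rightarrow> 'a \<Rightarrow> real" where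
  "kelvin_kernel a x l y v = norm (y - v) powr (- a)
     - (l / norm (y - x)) powr a * norm (inversion x l y - v) powr (- a)"

lemma kelvin_kernel_le: "kelvin_kernel a x l y v \<le> norm (y - v) powr (- a)"
  by (simp add: kelvin_kernel_def)

text \<open>By \<open>inversion_dist_sq\<close> the claim reduces to
  \<open>l * |y - v| \<le> |y - x| * |inversion x l y - v|\<close>. The point \<open>v = y\<close>
  is excluded because \<open>0 powr (- a)\<close> is 0 rather than infinite.\<close>

lemma kelvin_kernel_nonneg:
  assumes "0 < a" "0 < l" "l < norm (y - x)" "l \<le> norm (v - x)" "v \<noteq> y"
  shows "0 \<le> kelvin_kernel a x l y v"
proof -
  define Y where "Y = norm (y - x)"
  define A where "A = norm (inversion x l y - v)"
  define B where "B = norm (y - v)"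
  have Y: "0 < Y" "l < Y" using assms by (auto simp: Y_def)
  have B: "0 < B" using assms by (simp add: B_def)
  have yx: "y \<noteq> x" using assms by auto
  have "0 \<le> (Y\<^sup>2 - l\<^sup>2) * ((norm (v - x))\<^sup>2 - l\<^sup>2)"
    using assms Y by (intro mult_nonneg_nonneg) (auto intro!: power_mono)
  also have "\<dots> = (Y * A)\<^sup>2 - (l * B)\<^sup>2"
    using inversion_dist_sq[OF yx, of l v] by (simp add: Y_def A_def B_def power_mult_distrib)
  finally have sq: "(l * B)\<^sup>2 \<le> (Y * A)\<^sup>2" by simp
  have "0 \<le> Y * A" using Y by (simp add: A_def)
  with sq have "l * B \<le> Y * A" by (rule power2_le_imp_le)
  then have "(Y * A) powr (- a) \<le> (l * B) powr (- a)"
    using assms B by (intro powr_mono2') auto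
  then have "l powr a * (Y * A) powr (- a) \<le> l powr a * (l * B) powr (- a)"
    by (intro mult_left_mono) auto
  moreover have "l powr a * (l * B) powr (- a) = B powr (- a)"
    using assms B by (simp add: powr_mult powr_minus field_simps)
  moreover have "l powr a * (Y * A) powr (- a) = (l / Y) powr a * A powr (- a)"
    using assms Y by (simp add: powr_mult powr_divide powr_minus A_def field_simps)
  ultimately show ?thesis
    by (simp add: kelvin_kernel_def Y_def A_def B_def)
qed

text \<open>The kernel is odd under reflection of its second argument, up to the conformal weight.
  This folds the part of the integral inside the sphere onto the part outside it.\<close>

lemma kelvin_kernel_inversion:
  assumes "0 < l" "y \<noteq> x" "w \<noteq> x"
  shows "(l / norm (w - x)) powr a * kelvin_kernel a x l y (inversion x l w) = - kelvin_kernel a x l y w"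
proof -
  define Y where "Y = norm (y - x)"
  define W where "W = norm (w - x)"
  define A where "A = norm (inversion x l y - w)"
  define B where "B = norm (y - w)"
  define D where "D = norm (y - inversion x l w)"
  define E where "E = norm (inversion x l y - inversion x l w)"
  have pos: "0 < Y" "0 < W" "0 \<le> A" "0 \<le> B" "0 \<le> D" "0 \<le> E"
    using assms by (auto simp: Y_def W_def A_def B_def D_def E_def)
  have "W * D = Y * A"
    using norm_inversion_swap[OF assms(2,3), of l] assms by (simp add: Y_def W_def A_def D_def)
  then have "W powr (- a) * D powr (- a) = Y powr (- a) * A powr (- a)"
    using pos by (metis powr_mult)
  then have 1: "(l / W) powr a * D powr (- a) = (l / Y) powr a * A powr (- a)"
    using assms pos by (simp add: powr_divide powr_minus field_simps)
  have "E = l\<^sup>2 * B / (Y * W)"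
    using norm_inversion_diff[OF assms(2,3), of l] by (simp add: Y_def W_def B_def E_def)
  then have "B = (Y / l) * (W / l) * E"
    using assms pos by (simp add: field_simps power2_eq_square)
  then have "B powr (- a) = ((Y / l) * (W / l) * E) powr (- a)" by (rule arg_cong)
  also have "\<dots> = (Y / l) powr (- a) * (W / l) powr (- a) * E powr (- a)"
    using assms pos by (simp only: powr_mult)
  finally have "B powr (- a) = (Y / l) powr (- a) * (W / l) powr (- a) * E powr (- a)" .
  moreover have "(t / l) powr (- a) = (l / t) powr a" if "0 < t" for t
    using that assms by (simp add: powr_divide powr_minus field_simps)
  ultimately have 2: "B powr (- a) = (l / Y) powr a * (l / W) powr a * E powr (- a)"
    using pos by simp
  show ?thesis
    unfolding kelvin_kernel_def Y_def[symmetric] W_def[symmetric] A_def[symmetric] B_def[symmetric]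
      D_def[symmetric] E_def[symmetric]
    using 1 2 by (simp add: algebra_simps)
qed

text \<open>Near the centre the kernel is negative. It has to vanish at the sphere to the same order
  as the gain from \<open>h\<close>, so a bound by a constant alone would not suffice.\<close>

lemma kelvin_kernel_inner_bound:
  assumes a: "0 < a" and l: "0 < l" "l < norm (y - x)" and \<rho>: "norm (y - x) < \<rho> / 2"
    and v: "norm (v - x) \<le> l\<^sup>2 / \<rho>"
  shows "- kelvin_kernel a x l y v \<le> 6 * (2 / l) powr a * (1 - (l / norm (y - x)) powr (a / 2))"
proof -
  define Y where "Y = norm (y - x)"
  define A where "A = norm (inversion x l y - v)"
  define B where "B = norm (y - v)"
  define t where "t = Y / l"
  define q where "q = (l / Y) powr (a / 2)"
  have Y: "0 < Y" "l < Y" "Y < \<rho> / 2" using assms by (auto simp: Y_def)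
  then have "0 < \<rho>" by simp
  have t: "1 < t" using Y l by (simp add: t_def)
  have q: "0 < q" "q \<le> 1" using Y l a by (auto simp: q_def intro!: powr_le1)
  \<comment> \<open>Since \<open>\<rho> > 2 * Y\<close>, the reflected point at distance
    \<open>l^2 / Y\<close> from \<open>x\<close> is at least twice as far out as
    \<open>v\<close>.\<close>
  have "l\<^sup>2 / \<rho> \<le> l\<^sup>2 / (2 * Y)"
    using Y l by (intro divide_left_mono) auto
  moreover have "l\<^sup>2 / Y \<le> A + norm (v - x)"
    using norm_triangle_ineq[of "inversion x l y - v" "v - x"]
    by (simp add: norm_inversion_center A_def Y_def)
  ultimately have A: "l\<^sup>2 / (2 * Y) \<le> A" using v by simp
  then have Apos: "0 < A" using Y l by (auto intro: less_le_trans[of 0 "l\<^sup>2 / (2 * Y)"])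
  have "l\<^sup>2 / \<rho> < l" using Y l \<open>0 < \<rho>\<close> by (simp add: field_simps power2_eq_square)
  then have "v \<noteq> y" using v Y by (auto simp: Y_def)
  then have B: "0 < B" by (simp add: B_def)
  have "norm (y - inversion x l y) = Y - l\<^sup>2 / Y"
  proof -
    have "y - inversion x l y = (1 - l\<^sup>2 / Y\<^sup>2) *\<^sub>R (y - x)"
      by (simp add: inversion_def Y_def algebra_simps)
    moreover have "0 \<le> 1 - l\<^sup>2 / Y\<^sup>2" using Y l by (simp add: field_simps power_mono)
    ultimately have "norm (y - inversion x l y) = (1 - l\<^sup>2 / Y\<^sup>2) * Y"
      by (simp add: Y_def)
    also have "\<dots> = Y - l\<^sup>2 / Y" using Y by (simp add: field_simps power2_eq_square)
    finally show ?thesis .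
  qed
  then have "B \<le> A + (Y - l\<^sup>2 / Y)"
    using norm_triangle_ineq[of "y - inversion x l y" "inversion x l y - v"] by (simp add: A_def B_def)
  also have "Y - l\<^sup>2 / Y = 2 * (t\<^sup>2 - 1) * (l\<^sup>2 / (2 * Y))"
    using Y l by (simp add: t_def field_simps power2_eq_square)
  also have "\<dots> \<le> 2 * (t\<^sup>2 - 1) * A"
    using A t by (intro mult_left_mono) auto
  finally have "B \<le> (2 * t\<^sup>2 - 1) * A" by (simp add: algebra_simps)
  also have "\<dots> \<le> t ^ 4 * A"
  proof (rule mult_right_mono)
    have "0 \<le> (t\<^sup>2 - 1)\<^sup>2" by simp
    then show "2 * t\<^sup>2 - 1 \<le> t ^ 4" by (simp add: power2_diff flip: power_mult)
  qed (use Apos in simp)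
  finally have "(t ^ 4 * A) powr (- a) \<le> B powr (- a)"
    using B a by (intro powr_mono2') auto
  \<comment> \<open>\<open>t powr (- 4 * a) = q ^ 8\<close>, and \<open>q ^ 2\<close> is the weight
    \<open>(l / Y) powr a\<close>. The remaining \<open>q ^ 6\<close> produces the factor 6 through
    Bernoulli's inequality.\<close>
  moreover have "(t ^ 4 * A) powr (- a) = q ^ 6 * ((l / Y) powr a * A powr (- a))"
  proof -
    have lY: "l / Y > 0" using l Y by simp
    have "(t ^ 4) powr (- a) = (t powr 4) powr (- a)" using t by simp
    also have "\<dots> = t powr (- (4 * a))" by (simp only: powr_powr) simp
    also have "\<dots> = inverse (l / Y) powr (- (4 * a))" by (simp add: t_def)
    also have "\<dots> = (l / Y) powr (4 * a)"
      unfolding inverse_powr powr_minus by simp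
    also have "(l / Y) powr (4 * a) = (l / Y) powr (a / 2 * 6) * (l / Y) powr a"
      by (simp flip: powr_add)
    also have "(l / Y) powr (a / 2 * 6) = q ^ 6"
      using q lY unfolding q_def by (simp only: powr_powr[symmetric]) simp
    finally show ?thesis using t Apos by (simp add: powr_mult)
  qed
  ultimately have "- kelvin_kernel a x l y v \<le> ((l / Y) powr a * A powr (- a)) * (1 - q ^ 6)"
    by (simp add: kelvin_kernel_def Y_def A_def B_def algebra_simps)
  also have "\<dots> \<le> (2 / l) powr a * (6 * (1 - q))"
  proof (rule mult_mono)
    have "A powr (- a) \<le> (l\<^sup>2 / (2 * Y)) powr (- a)"
      using A Y l a by (intro powr_mono2') auto
    then have "(l / Y) powr a * A powr (- a) \<le> (l / Y) powr a * (l\<^sup>2 / (2 * Y)) powr (- a)"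
      by (intro mult_left_mono) auto
    also have "\<dots> = (l / Y) powr a * (2 * Y / l\<^sup>2) powr a"
      using Y l by (simp add: powr_divide powr_minus field_simps)
    also have "\<dots> = (2 / l) powr a"
      using Y l by (simp add: powr_mult[symmetric] power2_eq_square)
    finally show "(l / Y) powr a * A powr (- a) \<le> (2 / l) powr a" .
    show "1 - q ^ 6 \<le> 6 * (1 - q)"
      using Bernoulli_inequality[of "q - 1" 6] q by simp
    show "0 \<le> 1 - q ^ 6" using q by (simp add: power_le_one)
  qed simp
  finally show ?thesis by (simp add: q_def Y_def algebra_simps)
qed

text \<open>The reason is that \<open>r powr (a / 2) * h\<close> increases along rays from \<open>x\<close> as long as \<open>r\<close> is small.\<close>

lemma kelvin_log_lipschitz:
  fixes h :: "'a::real_inner \<Rightarrow> real"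
  assumes l: "0 < l" "l < norm (y - x)" and M: "0 \<le> M" "4 * M * norm (y - x) \<le> a"
    and h: "h (inversion x l y) \<le> h y * exp (M * norm (inversion x l y - y))" "0 \<le> h y"
  shows "(l / norm (y - x)) powr a * h (inversion x l y) \<le> (l / norm (y - x)) powr (a / 2) * h y"
proof -
  define Y where "Y = norm (y - x)"
  define s where "s = l / Y"
  have Y: "0 < Y" "l < Y" using assms by (auto simp: Y_def)
  have s: "0 < s" "s < 1" using Y l by (auto simp: s_def)
  have "norm (inversion x l y - y) = Y * (1 - s\<^sup>2)"
  proof -
    have "inversion x l y - y = - ((1 - l\<^sup>2 / Y\<^sup>2) *\<^sub>R (y - x))"
      by (simp add: inversion_def Y_def algebra_simps)
    moreover have "0 \<le> 1 - s\<^sup>2" using s by (simp add: power_le_one)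
    ultimately show ?thesis by (simp add: Y_def s_def power_divide)
  qed
  then have "M * norm (inversion x l y - y) = (4 * M * Y) * ((1 - s\<^sup>2) / 4)" by simp
  also have "\<dots> \<le> a * ((1 - s\<^sup>2) / 4)"
    using M s by (intro mult_right_mono) (auto simp: Y_def power_le_one)
  also have "1 - s\<^sup>2 \<le> - 2 * ln s"
    using ln_le_minus_one[of "s\<^sup>2"] s by (simp add: ln_realpow)
  then have "a * ((1 - s\<^sup>2) / 4) \<le> a * (- 2 * ln s / 4)"
    using M s Y by (intro mult_left_mono divide_right_mono) (auto intro: order_trans[OF _ M(2)])
  finally have "exp (M * norm (inversion x l y - y)) \<le> s powr (- (a / 2))"
    using s by (simp add: powr_def)
  then have "h (inversion x l y) \<le> h y * s powr (- (a / 2))"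
    using h by (meson mult_left_mono order_trans)
  then have "s powr a * h (inversion x l y) \<le> s powr a * (h y * s powr (- (a / 2)))"
    by (intro mult_left_mono) auto
  also have "\<dots> = (s powr a * s powr (- (a / 2))) * h y" by simp
  also have "s powr a * s powr (- (a / 2)) = s powr (a / 2)"
    by (simp flip: powr_add)
  finally show ?thesis by (simp add: s_def Y_def)
qed

section \<open>Moving spheres\<close>

text \<open>Mean value theorem; \<open>s = 0\<close> is separate because \<open>powr\<close> is
  differentiated only at positive bases.\<close>

lemma powr_diff_le:
  fixes s t p :: real
  assumes "0 \<le> s" "s \<le> t" "1 \<le> p"
  shows "t powr p - s powr p \<le> p * t powr (p - 1) * (t - s)"
proof (cases "s = 0 \<or> s = t")
  case True
  have "t powr p = t powr (p - 1) * t" if "0 < t"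
    using powr_add[of t "p - 1" 1] that by simp
  then show ?thesis
    using True assms mult_right_mono[of 1 p "t powr p"] by (cases "t = 0") auto
next
  case False
  then have st: "0 < s" "s < t" using assms by auto
  have "\<exists>z. z > s \<and> z < t \<and> t powr p - s powr p = (t - s) * (p * z powr (p - 1))"
    by (rule MVT2[OF st(2)]) (use st in \<open>auto intro!: derivative_eq_intros\<close>)
  then obtain z where z: "s < z" "z < t" "t powr p - s powr p = (t - s) * (p * z powr (p - 1))"
    by blast
  have "z powr (p - 1) \<le> t powr (p - 1)"
    using z st assms by (intro powr_mono2) auto
  then have "(t - s) * (p * z powr (p - 1)) \<le> (t - s) * (p * t powr (p - 1))"
    using assms by (intro mult_left_mono) auto
  then show ?thesis using z(3) by (simp add: mult_ac)
qed

text \<open>Used with \<open>T = insert y \<Sigma>\<close>, where neither \<open>u\<close> nor the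
  kernel is controlled. A nonintegrable \<open>f\<close> has integral 0, consistent with the
  conclusion.\<close>

lemma set_integral_nonneg_off_negligible:
  fixes f :: "'a::euclidean_space \<Rightarrow> real"
  assumes "negligible T" "\<And>w. w \<in> S \<Longrightarrow> w \<notin> T \<Longrightarrow> 0 \<le> f w"
  shows "0 \<le> (LINT w:S|lebesgue. f w)"
  unfolding set_lebesgue_integral_def
proof (rule integral_nonneg_AE)
  have "AE w in lebesgue. w \<notin> T"
    using assms(1) by (simp add: negligible_iff_null_sets AE_not_in)
  then show "AE w in lebesgue. 0 \<le> indicat_real S w *\<^sub>R f w"
    by eventually_elim (use assms(2) in \<open>auto simp: indicator_def\<close>)
qed

lemma set_integral_mono_off_negligible:
  fixes f :: "'a::euclidean_space \<Rightarrow> real"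
  assumes "set_integrable lebesgue S f" "set_integrable lebesgue S g"
    "negligible T" "\<And>w. w \<in> S \<Longrightarrow> w \<notin> T \<Longrightarrow> f w \<le> g w"
  shows "(LINT w:S|lebesgue. f w) \<le> (LINT w:S|lebesgue. g w)"
  using set_integral_nonneg_off_negligible[of T S "\<lambda>w. g w - f w"] assms
  by simp

text \<open>Here \<open>a = n - 2 * \<sigma>\<close>, and \<open>a * p = 2 * n - a\<close> says that
  \<open>p\<close> is the conformally critical exponent. \<Sigma> enters only as a closed null set;
  its geometry is used later, through the balls that avoid it.\<close>

locale singular_solution =
  fixes a p :: real and \<Sigma> \<Omega> :: "(real^'n) set" and u h :: "real^'n \<Rightarrow> real"
  assumes a: "0 < a" "a < CARD('n)"
    and ap: "a * p = 2 * CARD('n) - a"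
    and open_domain: "open \<Omega>"
    and closed_sing: "closed \<Sigma>"
    and negligible_sing: "negligible \<Sigma>"
    and cont: "continuous_on (\<Omega> - \<Sigma>) u"
    and h_pos: "\<And>x. x \<in> \<Omega> \<Longrightarrow> 0 < h x"
    and int: "\<And>x. x \<in> \<Omega> - \<Sigma> \<Longrightarrow> set_integrable lebesgue \<Omega> (\<lambda>y. u y powr p / norm (x - y) powr a)"
    and eq: "\<And>x. x \<in> \<Omega> - \<Sigma> \<Longrightarrow> u x = (LINT y:\<Omega>|lebesgue. u y powr p / norm (x - y) powr a) + h x"
begin

lemma p_gt_1: "1 < p"
proof -
  have "a * 1 < a * p" using a ap by simp
  then show ?thesis using a by (simp only: mult_less_cancel_left_pos)
qed

lemma h_le_u: "h x \<le> u x" if "x \<in> \<Omega> - \<Sigma>"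
  using eq[OF that] set_integral_nonneg_off_negligible[of "{}" \<Omega> "\<lambda>y. u y powr p / norm (x - y) powr a"]
  by simp

lemma u_pos: "0 < u x" if "x \<in> \<Omega> - \<Sigma>"
  using h_le_u[OF that] h_pos[of x] that by simp

lemma dist_power_integrable: "x \<in> \<Omega> - \<Sigma> \<Longrightarrow>
    set_integrable lebesgue \<Omega> (\<lambda>y. u y powr p * norm (x - y) powr (- a))"
  using int[of x] by (simp add: powr_minus divide_inverse)

lemma u_eq: "x \<in> \<Omega> - \<Sigma> \<Longrightarrow>
    u x = (LINT y:\<Omega>|lebesgue. u y powr p * norm (x - y) powr (- a)) + h x"
  using eq[of x] by (simp add: powr_minus divide_inverse)

lemma cball_bounded_above:
  assumes "cball x r \<subseteq> \<Omega> - \<Sigma>"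
  obtains m where "0 < m" "\<And>w. w \<in> cball x r \<Longrightarrow> u w \<le> m"
proof -
  have "compact (u ` cball x r)"
    using continuous_on_subset[OF cont assms] by (intro compact_continuous_image) auto
  then obtain m where "\<forall>t\<in>u ` cball x r. \<bar>t\<bar> \<le> m"
    using compact_imp_bounded bounded_real by blast
  then show thesis by (intro that[of "max 1 m"]) force+
qed

end

text \<open>\<open>2 * M * \<rho> \<le> a\<close> gives the hypothesis of
  \<open>kelvin_log_lipschitz\<close> for \<open>|y - x| \<le> \<rho> / 2\<close>. The second
  condition in \<open>eps\<close> puts the Kelvin transform below \<open>h\<close> beyond distance
  \<open>\<rho> / 2\<close>; the third pays for the ball of radius \<open>l^2 / \<rho>\<close> with
  half of the gain from \<open>h\<close>.\<close>

locale moving_sphere = singular_solution a p \<Sigma> \<Omega> u h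
  for a p :: real and \<Sigma> \<Omega> :: "(real^'n) set" and u h :: "real^'n \<Rightarrow> real" +
  fixes x :: "real^'n" and \<rho> c0 M \<epsilon> :: real
  assumes rho: "0 < \<rho>" and cball_sub: "cball x \<rho> \<subseteq> \<Omega>"
    and c0: "0 < c0" "\<And>y. y \<in> cball x \<rho> \<Longrightarrow> c0 \<le> h y"
    and M: "0 \<le> M" "2 * M * \<rho> \<le> a"
    and h_lip: "\<And>y y'. y \<in> cball x \<rho> \<Longrightarrow> y' \<in> cball x \<rho> \<Longrightarrow> h y \<le> h y' * exp (M * norm (y - y'))"
    and eps: "0 < \<epsilon>" "(2 / \<rho>) powr a * \<epsilon> \<le> c0"
      "6 * 2 powr a * unit_ball_vol CARD('n) / \<rho> ^ CARD('n) * \<epsilon> powr p \<le> c0 / 2"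
begin

definition kelvin :: "real \<Rightarrow> real^'n \<Rightarrow> real" where
  "kelvin l y = (l / norm (y - x)) powr a * u (inversion x l y)"

definition dominated :: "real \<Rightarrow> bool" where
  "dominated l \<longleftrightarrow> (\<forall>y\<in>ball x \<rho> - \<Sigma>. l \<le> norm (y - x) \<longrightarrow> kelvin l y \<le> u y)"

definition ring :: "real \<Rightarrow> (real^'n) set" where
  "ring l = {w. l < norm (w - x) \<and> norm (w - x) < \<rho>}"

text \<open>The domain splits into \<open>B0\<close>, \<open>B1\<close>, the ring and the rest. The
  kernel is nonnegative on the rest, \<open>B1\<close> is reflected onto the ring, and
  \<open>B0\<close> costs at most half of the gain \<open>c0 * (1 - q)\<close> from
  \<open>h\<close>. Domination is not assumed, so the inequality serves to prove it as well as to
  sharpen it.\<close>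

lemma kelvin_inequality:
  assumes l: "0 < l" and disj: "cball x l \<inter> \<Sigma> = {}"
    and small: "\<And>w. w \<in> cball x (l\<^sup>2 / \<rho>) \<Longrightarrow> l powr a * u w \<le> \<epsilon>"
    and y: "y \<notin> \<Sigma>" "l < norm (y - x)" "norm (y - x) < \<rho> / 2"
  shows "set_integrable lebesgue (ring l) (\<lambda>w. kelvin_kernel a x l y w * (u w powr p - kelvin l w powr p))"
    "kelvin l y + (LINT w:ring l|lebesgue. kelvin_kernel a x l y w * (u w powr p - kelvin l w powr p))
      + c0 / 2 * (1 - (l / norm (y - x)) powr (a / 2)) \<le> u y"
proof -
  define Y where "Y = norm (y - x)"
  define q where "q = (l / Y) powr (a / 2)"
  define y' where "y' = inversion x l y"
  define K where "K = kelvin_kernel a x l y"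
  define G where "G = (\<lambda>v. u v powr p * K v)"
  define B0 where "B0 = cball x (l\<^sup>2 / \<rho>)"
  define B1 where "B1 = {v. l\<^sup>2 / \<rho> < norm (v - x) \<and> norm (v - x) < l}"
  have Y: "0 < Y" "l < Y" "Y < \<rho> / 2" using y l by (auto simp: Y_def)
  have l\<rho>: "l < \<rho>" using Y rho by simp
  have q: "0 < q" "q \<le> 1" using Y l a by (auto simp: q_def intro!: powr_le1)
  have small_rad: "l\<^sup>2 / \<rho> < l" using l l\<rho> by (simp add: field_simps power2_eq_square)
  have yx: "y \<noteq> x" using Y by (auto simp: Y_def)
  have cl: "cball x l \<subseteq> \<Omega> - \<Sigma>" using disj cball_sub l\<rho> by auto
  have "dist x y = Y" by (simp add: Y_def dist_norm norm_minus_commute)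
  then have y_in: "y \<in> \<Omega> - \<Sigma>" "y \<in> cball x \<rho>"
    using y(1) cball_sub Y by (auto simp: subset_eq)
  have "norm (y' - x) = l\<^sup>2 / Y" by (simp add: y'_def norm_inversion_center Y_def)
  also have "\<dots> \<le> l" using Y l by (simp add: field_simps power2_eq_square)
  finally have y'_in: "y' \<in> cball x l" by (simp add: dist_norm norm_minus_commute)
  have sub: "B0 \<subseteq> \<Omega>" "B1 \<subseteq> \<Omega>" "ring l \<subseteq> \<Omega>"
    using cball_sub small_rad l\<rho> by (auto simp: B0_def B1_def ring_def subset_eq dist_norm norm_minus_commute)
  have [measurable]: "\<Omega> \<in> sets borel" "B0 \<in> sets borel" "B1 \<in> sets borel" "ring l \<in> sets borel"
    using open_domain by (auto simp: B0_def B1_def ring_def)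
  have leb: "\<Omega> \<in> sets lebesgue" "B0 \<in> sets lebesgue" "B1 \<in> sets lebesgue" "ring l \<in> sets lebesgue"
    by auto
  have G_eq: "G v = u v powr p * norm (y - v) powr (- a)
      - (l / Y) powr a * (u v powr p * norm (y' - v) powr (- a))" for v
    by (simp add: G_def K_def kelvin_kernel_def Y_def y'_def algebra_simps)
  have Gint: "set_integrable lebesgue \<Omega> G"
    unfolding G_eq using dist_power_integrable[OF y_in(1)] dist_power_integrable[of y'] y'_in cl
    by (intro set_integral_diff(1) set_integrable_mult_right) auto
  note Gsub = set_integrable_subset[OF Gint]
  have "(LINT v:\<Omega>|lebesgue. G v) = (LINT v:\<Omega>|lebesgue. u v powr p * norm (y - v) powr (- a))
     - (l / Y) powr a * (LINT v:\<Omega>|lebesgue. u v powr p * norm (y' - v) powr (- a))"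
    unfolding G_eq using dist_power_integrable[OF y_in(1)] dist_power_integrable[of y'] y'_in cl
    by (subst set_integral_diff(2)) auto
  then have main: "u y - kelvin l y = (LINT v:\<Omega>|lebesgue. G v) + (h y - (l / Y) powr a * h y')"
    using u_eq[OF y_in(1)] u_eq[of y'] y'_in cl
    by (auto simp: kelvin_def Y_def y'_def algebra_simps)
  have h: "c0 * (1 - q) \<le> h y - (l / Y) powr a * h y'"
  proof -
    have "4 * M * Y \<le> 4 * M * (\<rho> / 2)" using M Y by (intro mult_left_mono) auto
    then have "(l / Y) powr a * h y' \<le> q * h y"
      unfolding Y_def y'_def q_def using y_in y'_in l\<rho> c0(2)[OF y_in(2)] c0(1) y M l
      by (intro kelvin_log_lipschitz[where M = M] h_lip) (auto simp: y'_def Y_def)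
    moreover have "c0 * (1 - q) \<le> h y * (1 - q)"
      using c0(2)[OF y_in(2)] q by (intro mult_right_mono) auto
    ultimately show ?thesis by (simp add: algebra_simps)
  qed
  have "(LINT v:B0 \<union> B1 \<union> ring l|lebesgue. G v) \<le> (LINT v:\<Omega>|lebesgue. G v)"
  proof -
    have "(LINT v:\<Omega>|lebesgue. G v)
      = (LINT v:(B0 \<union> B1 \<union> ring l) \<union> (\<Omega> - (B0 \<union> B1 \<union> ring l))|lebesgue. G v)"
      using sub by (intro arg_cong2[where f = "\<lambda>S. set_lebesgue_integral lebesgue S"]) auto
    also have "\<dots> = (LINT v:B0 \<union> B1 \<union> ring l|lebesgue. G v)
      + (LINT v:\<Omega> - (B0 \<union> B1 \<union> ring l)|lebesgue. G v)"
      using leb sub by (intro set_integral_Un Gsub) auto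
    moreover have "0 \<le> (LINT v:\<Omega> - (B0 \<union> B1 \<union> ring l)|lebesgue. G v)"
    proof (rule set_integral_nonneg_off_negligible[of "{}"])
      fix v assume "v \<in> \<Omega> - (B0 \<union> B1 \<union> ring l)"
      then have "l \<le> norm (v - x)" "v \<noteq> y"
        using Y rho by (auto simp: B0_def B1_def ring_def Y_def dist_norm norm_minus_commute)
      then show "0 \<le> G v"
        using kelvin_kernel_nonneg[OF a(1) l y(2)] by (simp add: G_def K_def)
    qed simp
    ultimately show ?thesis by simp
  qed
  also have "(LINT v:B0 \<union> B1 \<union> ring l|lebesgue. G v)
      = (LINT v:B0|lebesgue. G v) + (LINT v:B1|lebesgue. G v) + (LINT v:ring l|lebesgue. G v)"
  proof -
    have "(B0 \<union> B1) \<inter> ring l = {}" "B0 \<inter> B1 = {}"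
      using small_rad by (auto simp: B0_def B1_def ring_def dist_norm norm_minus_commute)
    then show ?thesis
      using leb sub by (simp add: set_integral_Un Gsub)
  qed
  finally have split: "(LINT v:B0|lebesgue. G v) + (LINT v:B1|lebesgue. G v) + (LINT v:ring l|lebesgue. G v)
      \<le> (LINT v:\<Omega>|lebesgue. G v)" .
  have bulk: "- (c0 / 2 * (1 - q)) \<le> (LINT v:B0|lebesgue. G v)"
  proof -
    define c where "c = 6 * (2 / l) powr a * (1 - q) * (\<epsilon> / l powr a) powr p"
    have lb: "- c \<le> G v" if v: "v \<in> B0" for v
    proof -
      have nv: "norm (v - x) \<le> l\<^sup>2 / \<rho>" using v by (simp add: B0_def dist_norm norm_minus_commute)
      have "u v \<le> \<epsilon> / l powr a"
        using small[of v] v l by (simp add: B0_def field_simps)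
      moreover have "0 < u v"
        using v small_rad cl by (intro u_pos) (auto simp: B0_def subset_eq)
      ultimately have up: "u v powr p \<le> (\<epsilon> / l powr a) powr p"
        using p_gt_1 by (intro powr_mono2) auto
      have "- K v \<le> 6 * (2 / l) powr a * (1 - q)"
        unfolding K_def q_def Y_def by (rule kelvin_kernel_inner_bound[OF a(1) l y(2,3) nv])
      then have "u v powr p * (- K v) \<le> u v powr p * (6 * (2 / l) powr a * (1 - q))"
        by (intro mult_left_mono) auto
      also have "\<dots> \<le> (\<epsilon> / l powr a) powr p * (6 * (2 / l) powr a * (1 - q))"
        using up q by (intro mult_right_mono) auto
      finally show ?thesis by (simp add: G_def c_def mult_ac)
    qed
    have mB: "measure lebesgue B0 = unit_ball_vol CARD('n) * (l\<^sup>2 / \<rho>) ^ CARD('n)"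
      using rho by (simp add: B0_def content_cball)
    have fin: "B0 \<in> lmeasurable" by (simp add: B0_def)
    then have ci: "set_integrable lebesgue B0 (\<lambda>v. - c)"
      by (simp add: set_integrable_def fmeasurable_def integrable_real_mult_indicator)
    have "c * measure lebesgue B0 \<le> c0 / 2 * (1 - q)"
    proof -
      have l2n: "(l\<^sup>2) ^ CARD('n) = l powr (2 * CARD('n))"
        using l by (simp add: powr_realpow flip: power_mult of_nat_mult)
      \<comment> \<open>The kernel contributes \<open>l powr (- a)\<close>, the bound on
        \<open>u powr p\<close> contributes \<open>l powr (- a * p)\<close>, and the volume
        \<open>l powr (2 * n)\<close>. They cancel, so one \<epsilon> works for all radii.\<close>
      have "(2 / l) powr a * (\<epsilon> / l powr a) powr p * (l\<^sup>2 / \<rho>) ^ CARD('n)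
        = 2 powr a * \<epsilon> powr p / \<rho> ^ CARD('n) * (l powr (2 * CARD('n)) / (l powr a * l powr (a * p)))"
        using l by (simp add: powr_divide powr_powr power_divide l2n)
      also have "l powr a * l powr (a * p) = l powr (2 * CARD('n))"
        by (simp add: ap flip: powr_add)
      also have "2 powr a * \<epsilon> powr p / \<rho> ^ CARD('n) * (l powr (2 * CARD('n)) / l powr (2 * CARD('n)))
        = 2 powr a * \<epsilon> powr p / \<rho> ^ CARD('n)" using l by simp
      finally have *: "(2 / l) powr a * (\<epsilon> / l powr a) powr p * (l\<^sup>2 / \<rho>) ^ CARD('n)
        = 2 powr a * \<epsilon> powr p / \<rho> ^ CARD('n)" .
      have "c * measure lebesgue B0 = 6 * (1 - q) * unit_ball_vol CARD('n)
         * ((2 / l) powr a * (\<epsilon> / l powr a) powr p * (l\<^sup>2 / \<rho>) ^ CARD('n))"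
        unfolding c_def mB by simp
      then have X: "c * measure lebesgue B0
         = (6 * 2 powr a * unit_ball_vol CARD('n) / \<rho> ^ CARD('n) * \<epsilon> powr p) * (1 - q)"
        unfolding * by simp
      show ?thesis unfolding X by (rule mult_right_mono[OF eps(3)]) (use q in simp)
    qed
    then have "- (c0 / 2 * (1 - q)) \<le> - c * measure lebesgue B0" by simp
    also have "\<dots> = (LINT v:B0|lebesgue. - c)"
      using fin by (simp add: set_lebesgue_integral_def)
    also have "\<dots> \<le> (LINT v:B0|lebesgue. G v)"
      using lb leb sub by (intro set_integral_mono_off_negligible[of _ _ _ "{}"] ci Gsub) auto
    finally show ?thesis .
  qed
  \<comment> \<open>The Jacobian exponent \<open>2 * n\<close> splits as \<open>a * p + a\<close>:
    the first part turns \<open>u powr p\<close> at the reflected point into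
    \<open>kelvin l w powr p\<close>, the second is the weight in the oddness of the kernel.\<close>
  have pt: "(l / norm (w - x)) ^ (2 * CARD('n)) * G (inversion x l w) = - (K w * kelvin l w powr p)"
    if w: "w \<in> ring l" for w
  proof -
    define W where "W = norm (w - x)"
    have W: "0 < W" "w \<noteq> x" using w l by (auto simp: W_def ring_def)
    define w' where "w' = inversion x l w"
    have "norm (w' - x) = l\<^sup>2 / W" by (simp add: w'_def norm_inversion_center W_def)
    also have "\<dots> \<le> l" using w l W by (simp add: field_simps power2_eq_square W_def ring_def)
    finally have "w' \<in> \<Omega> - \<Sigma>" using cl by (auto simp: subset_eq dist_norm norm_minus_commute)
    then have upos: "0 < u w'" by (rule u_pos)
    have k: "kelvin l w powr p = (l / W) powr (a * p) * u w' powr p"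
      by (simp add: kelvin_def powr_mult powr_powr W_def w'_def)
    have j: "(l / W) ^ (2 * CARD('n)) = (l / W) powr (a * p) * (l / W) powr a"
      using l W powr_realpow[of "l / W" "2 * CARD('n)"] by (simp add: ap flip: powr_add)
    have sw: "(l / W) powr a * K w' = - K w"
      unfolding K_def W_def w'_def by (rule kelvin_kernel_inversion[OF l yx W(2)])
    have "(l / W) ^ (2 * CARD('n)) * G w' = kelvin l w powr p * ((l / W) powr a * K w')"
      unfolding G_def j k by simp
    then show ?thesis
      unfolding sw W_def[symmetric] w'_def[symmetric] by simp
  qed
  have meas: "set_borel_measurable borel B1 G"
  proof -
    define f where "f = (\<lambda>v. indicat_real (cball x l) v *\<^sub>R u v)"
    have [measurable]: "f \<in> borel_measurable borel"
      unfolding f_def using continuous_on_subset[OF cont cl]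
      by (intro borel_measurable_continuous_on_indicator) auto
    have [measurable]: "K \<in> borel_measurable borel"
      unfolding K_def kelvin_kernel_def by measurable
    have "(\<lambda>v. indicat_real B1 v *\<^sub>R G v) = (\<lambda>v. indicat_real B1 v * (f v powr p * K v))"
      by (auto simp: G_def f_def B1_def indicator_def fun_eq_iff dist_norm norm_minus_commute)
    then show ?thesis by (simp add: set_borel_measurable_def)
  qed
  note cov = inversion_change_of_variables_lebesgue[OF l l\<rho> meas[unfolded B1_def],
      OF Gsub[OF leb(3) sub(2), unfolded B1_def], folded ring_def B1_def]
  have refl_int: "set_integrable lebesgue (ring l) (\<lambda>w. - (K w * kelvin l w powr p))"
    using cov(1) by (subst (asm) set_integrable_cong[OF refl refl pt])
  have refl_eq: "(LINT v:B1|lebesgue. G v) = (LINT w:ring l|lebesgue. - (K w * kelvin l w powr p))"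
    unfolding cov(2)[symmetric] by (rule set_lebesgue_integral_cong) (use pt leb in auto)
  have sum_eq: "K w * (u w powr p - kelvin l w powr p) = G w + - (K w * kelvin l w powr p)" for w
    by (simp add: G_def algebra_simps)
  show "set_integrable lebesgue (ring l) (\<lambda>w. kelvin_kernel a x l y w * (u w powr p - kelvin l w powr p))"
    unfolding K_def[symmetric] sum_eq by (intro set_integral_add refl_int Gsub leb sub)
  have "(LINT w:ring l|lebesgue. K w * (u w powr p - kelvin l w powr p))
      = (LINT v:ring l|lebesgue. G v) + (LINT v:B1|lebesgue. G v)"
    unfolding refl_eq sum_eq by (intro set_integral_add refl_int Gsub leb sub)
  moreover have "c0 * (1 - q) = c0 / 2 * (1 - q) + c0 / 2 * (1 - q)" by simp
  ultimately show "kelvin l y + (LINT w:ring l|lebesgue. kelvin_kernel a x l y w * (u w powr p - kelvin l w powr p))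
      + c0 / 2 * (1 - (l / norm (y - x)) powr (a / 2)) \<le> u y"
    using main split bulk h unfolding K_def[symmetric] Y_def[symmetric] q_def[symmetric] by linarith
qed

lemma dominated_strict:
  assumes l: "0 < l" and disj: "cball x l \<inter> \<Sigma> = {}"
    and small: "\<And>w. w \<in> cball x (l\<^sup>2 / \<rho>) \<Longrightarrow> l powr a * u w \<le> \<epsilon>"
    and dom: "dominated l"
    and y: "y \<notin> \<Sigma>" "l < norm (y - x)" "norm (y - x) < \<rho> / 2"
  shows "kelvin l y + c0 / 2 * (1 - (l / norm (y - x)) powr (a / 2)) \<le> u y"
proof -
  have l\<rho>: "l < \<rho>" using l y rho by simp
  have cl: "cball x l \<subseteq> \<Omega> - \<Sigma>" using disj cball_sub l\<rho> by auto
  have "0 \<le> (LINT w:ring l|lebesgue. kelvin_kernel a x l y w * (u w powr p - kelvin l w powr p))"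
  proof (rule set_integral_nonneg_off_negligible)
    show "negligible (insert y \<Sigma>)" using negligible_sing by simp
    fix w assume w: "w \<in> ring l" "w \<notin> insert y \<Sigma>"
    have "w \<in> ball x \<rho>" using w by (simp add: ring_def dist_norm norm_minus_commute)
    then have "kelvin l w \<le> u w" using dom w by (auto simp: dominated_def ring_def)
    moreover have "0 \<le> kelvin l w"
    proof -
      have "0 < norm (w - x)" using w l by (auto simp: ring_def)
      then have "l\<^sup>2 / norm (w - x) \<le> l"
        using w l by (simp add: ring_def field_simps power2_eq_square)
      then have "inversion x l w \<in> cball x l"
        using norm_inversion_center[of x l w] by (simp add: dist_norm norm_minus_commute)
      then show ?thesis using cl u_pos by (force simp: kelvin_def)
    qed
    ultimately have "kelvin l w powr p \<le> u w powr p"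
      using p_gt_1 by (intro powr_mono2) auto
    moreover have "0 \<le> kelvin_kernel a x l y w"
      using w by (intro kelvin_kernel_nonneg[OF a(1) l y(2)]) (auto simp: ring_def)
    ultimately show "0 \<le> kelvin_kernel a x l y w * (u w powr p - kelvin l w powr p)" by simp
  qed
  then show ?thesis
    using kelvin_inequality(2)[OF l disj small y] by simp
qed

text \<open>Points at distance at least \<open>R\<close> reflect into \<open>cball x R\<close> for
  every radius up to \<open>R\<close>, where \<open>u\<close> is continuous. Joint continuity allows
  the radius to be increased uniformly in \<open>y\<close>.\<close>

lemma kelvin_continuous:
  assumes "0 < l" "l \<le> R" "cball x R \<inter> \<Sigma> = {}" "R \<le> \<rho>"
  shows "continuous_on ({l..R} \<times> {y. R \<le> norm (y - x)}) (\<lambda>(t, y). kelvin t y)"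
proof -
  let ?S = "{l..R} \<times> {y. R \<le> norm (y - x)}"
  have ne: "norm (snd z - x) \<noteq> 0" if "z \<in> ?S" for z using that assms by auto
  have "continuous_on ?S (\<lambda>z. inversion x (fst z) (snd z))"
    unfolding inversion_def using ne by (intro continuous_intros) auto
  moreover have "inversion x (fst z) (snd z) \<in> \<Omega> - \<Sigma>" if z: "z \<in> ?S" for z
  proof -
    have "(fst z)\<^sup>2 / norm (snd z - x) \<le> R\<^sup>2 / R"
      using z assms by (intro frac_le power_mono) auto
    also have "\<dots> = R" by (simp add: power2_eq_square)
    finally have "inversion x (fst z) (snd z) \<in> cball x R"
      using norm_inversion_center[of x "fst z" "snd z"] by (simp add: dist_norm norm_minus_commute)
    then show ?thesis using assms cball_sub by auto
  qed
  ultimately have "continuous_on ?S (\<lambda>z. u (inversion x (fst z) (snd z)))"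
    by (intro continuous_on_compose2[OF cont]) auto
  then have "continuous_on ?S (\<lambda>z. (fst z / norm (snd z - x)) powr a * u (inversion x (fst z) (snd z)))"
    using ne assms by (intro continuous_intros) auto
  then show ?thesis by (simp add: kelvin_def case_prod_unfold)
qed

text \<open>On a thin annulus the Riesz potential is a contraction in the supremum norm, so the positive
  part of \<open>kelvin l - u\<close> vanishes there once it vanishes further out.\<close>

lemma dominated_if_outside:
  assumes l: "0 < l" "l < R" "R < \<rho> / 2" and disj: "cball x R \<inter> \<Sigma> = {}"
    and small: "\<And>w. w \<in> cball x (l\<^sup>2 / \<rho>) \<Longrightarrow> l powr a * u w \<le> \<epsilon>"
    and m: "0 < m" "\<And>w. w \<in> cball x l \<Longrightarrow> u w \<le> m"
    and thin: "\<And>y. set_integrable lebesgue {w. l \<le> norm (w - x) \<and> norm (w - x) < R} (\<lambda>w. norm (y - w) powr (- a))"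
      "\<And>y. (LINT w:{w. l \<le> norm (w - x) \<and> norm (w - x) < R}|lebesgue. norm (y - w) powr (- a))
        \<le> 1 / (2 * p * m powr (p - 1))"
    and outer: "\<And>y. y \<in> ball x \<rho> - \<Sigma> \<Longrightarrow> R \<le> norm (y - x) \<Longrightarrow> kelvin l y \<le> u y"
  shows "dominated l"
proof -
  define A where "A = {w. l \<le> norm (w - x) \<and> norm (w - x) < R}"
  define D where "D = {y. l \<le> norm (y - x) \<and> norm (y - x) \<le> R}"
  define g where "g y = kelvin l y - u y" for y
  have R\<rho>: "R < \<rho>" using l rho by simp
  have disjl: "cball x l \<inter> \<Sigma> = {}" using disj l subset_cball[of l R x] by fastforce
  have cR: "cball x R \<subseteq> \<Omega> - \<Sigma>" using disj cball_sub R\<rho> by auto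
  have inv_in: "inversion x l w \<in> cball x l" if "l \<le> norm (w - x)" for w
  proof -
    have "0 < norm (w - x)" using that l by linarith
    then have "l\<^sup>2 / norm (w - x) \<le> l"
      using that l by (simp add: field_simps power2_eq_square)
    then show ?thesis
      using norm_inversion_center[of x l w] by (simp add: dist_norm norm_minus_commute)
  qed
  have kel: "0 \<le> kelvin l w" "kelvin l w \<le> m" if w: "l \<le> norm (w - x)" for w
  proof -
    have up: "0 < u (inversion x l w)" "u (inversion x l w) \<le> m"
      using inv_in[OF w] cR l m(2) by (auto intro!: u_pos simp: subset_eq)
    show "0 \<le> kelvin l w" using up by (simp add: kelvin_def)
    have "l / norm (w - x) \<le> 1"
      using w l(1) by (subst divide_le_eq_1_pos) (auto intro: less_le_trans)
    then have "(l / norm (w - x)) powr a \<le> 1"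
      using l a by (intro powr_le1) auto
    then have "kelvin l w \<le> 1 * u (inversion x l w)"
      unfolding kelvin_def using up by (intro mult_right_mono) auto
    then show "kelvin l w \<le> m" using up by simp
  qed
  have "continuous_on D (kelvin l)"
  proof -
    have "continuous_on D (inversion x l)"
      unfolding inversion_def using l by (intro continuous_intros) (auto simp: D_def)
    moreover have "inversion x l y \<in> cball x R" if "y \<in> D" for y
      using inv_in[of y] that l by (auto simp: D_def)
    ultimately have "continuous_on D (\<lambda>y. u (inversion x l y))"
      by (intro continuous_on_compose2[OF cont]) (use cR in blast)+
    then show ?thesis
      unfolding kelvin_def[abs_def] using l by (intro continuous_intros) (auto simp: D_def)
  qed
  moreover have "continuous_on D u"
    using cR by (intro continuous_on_subset[OF cont]) (auto simp: D_def subset_eq dist_norm norm_minus_commute)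
  ultimately have gcont: "continuous_on D g"
    unfolding g_def[abs_def] by (intro continuous_intros)
  have "D = cball x R - ball x l"
    by (auto simp: D_def dist_norm norm_minus_commute)
  then have "compact D" by (simp add: compact_diff)
  show ?thesis
  proof (rule ccontr)
    assume "\<not> dominated l"
    then obtain y1 where y1: "y1 \<in> ball x \<rho> - \<Sigma>" "l \<le> norm (y1 - x)" "0 < g y1"
      by (auto simp: dominated_def g_def)
    then have "y1 \<in> D" using outer[of y1] by (force simp: D_def g_def)
    then obtain y where y: "y \<in> D" "\<And>w. w \<in> D \<Longrightarrow> g w \<le> g y"
      using continuous_attains_sup[OF \<open>compact D\<close> _ gcont] by blast
    then have gy: "0 < g y" using y1(3) \<open>y1 \<in> D\<close> by fastforce
    have y_in: "y \<in> ball x \<rho> - \<Sigma>"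
      using y(1) cR R\<rho> by (auto simp: D_def subset_eq dist_norm norm_minus_commute)
    have yR: "norm (y - x) < R" using outer[OF y_in] gy by (force simp: g_def)
    \<comment> \<open>The inversion fixes the sphere, so \<open>g\<close> vanishes there and its
      positive maximum lies strictly outside.\<close>
    have "norm (y - x) \<noteq> l"
    proof
      assume *: "norm (y - x) = l"
      then have "inversion x l y = y" using l by (simp add: inversion_def)
      then have "g y = 0" using * l by (simp add: g_def kelvin_def)
      then show False using gy by simp
    qed
    then have yl: "l < norm (y - x)" using y(1) by (simp add: D_def)
    have y\<rho>: "norm (y - x) < \<rho> / 2" using yR l by simp
    define c where "c = p * m powr (p - 1) * g y"
    have c: "0 \<le> c" using p_gt_1 gy by (simp add: c_def)
    note ki = kelvin_inequality[OF l(1) disjl small _ yl y\<rho>]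
    have yS: "y \<notin> \<Sigma>" using y_in by simp
    have [measurable]: "A \<in> sets borel" by (simp add: A_def)
    have "set_integrable lebesgue UNIV (\<lambda>w. indicator A w * norm (y - w) powr (- a))"
      using thin(1)[of y] by (simp add: A_def set_integrable_def)
    then have athin: "set_integrable lebesgue (ring l) (\<lambda>w. indicator A w * norm (y - w) powr (- a))"
      by (rule set_integrable_subset) (auto simp: ring_def)
    then have cthin: "set_integrable lebesgue (ring l) (\<lambda>w. - (c * (indicator A w * norm (y - w) powr (- a))))"
      by (simp add: set_integrable_def mult.left_commute[of _ c])
    have "(LINT w:ring l|lebesgue. indicator A w * norm (y - w) powr (- a))
        \<le> (LINT w:A|lebesgue. norm (y - w) powr (- a))"
      unfolding set_lebesgue_integral_def
      using thin(1)[of y] athin unfolding set_integrable_def A_def[symmetric]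
      by (intro integral_mono) (auto simp: indicator_def)
    then have "- (c * (LINT w:A|lebesgue. norm (y - w) powr (- a)))
      \<le> (LINT w:ring l|lebesgue. - (c * (indicator A w * norm (y - w) powr (- a))))"
      using c by (simp add: set_lebesgue_integral_def mult_left_mono mult.left_commute[of _ c])
    also have "\<dots> \<le> (LINT w:ring l|lebesgue. kelvin_kernel a x l y w * (u w powr p - kelvin l w powr p))"
    proof (rule set_integral_mono_off_negligible[OF cthin ki(1)[OF _ yS]])
      show "negligible (insert y \<Sigma>)" using negligible_sing by simp
      fix w assume w: "w \<in> ring l" "w \<notin> insert y \<Sigma>"
      have wl: "l \<le> norm (w - x)" using w by (simp add: ring_def)
      have w_in: "w \<in> ball x \<rho> - \<Sigma>" using w by (simp add: ring_def dist_norm norm_minus_commute)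
      have up: "0 < u w" using w_in cball_sub by (intro u_pos) auto
      have K: "0 \<le> kelvin_kernel a x l y w"
        using w by (intro kelvin_kernel_nonneg[OF a(1) l(1) yl]) (auto simp: ring_def)
      show "- (c * (indicator A w * norm (y - w) powr (- a)))
        \<le> kelvin_kernel a x l y w * (u w powr p - kelvin l w powr p)"
      proof (cases "kelvin l w \<le> u w")
        case True
        then have "kelvin l w powr p \<le> u w powr p"
          using p_gt_1 kel(1)[OF wl] by (intro powr_mono2) auto
        then have "0 \<le> kelvin_kernel a x l y w * (u w powr p - kelvin l w powr p)" using K by simp
        moreover have "0 \<le> c * (indicator A w * norm (y - w) powr (- a))" using c by simp
        ultimately show ?thesis by linarith
      next
        \<comment> \<open>Where domination fails, \<open>w\<close> lies in the thin annulus,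
          \<open>kelvin l w - u w \<le> g y\<close> by maximality, and the mean value bound with
          \<open>kelvin l w \<le> m\<close> gives the constant \<open>c\<close>.\<close>
        case False
        then have wR: "norm (w - x) < R" using outer[OF w_in] by force
        then have wA: "w \<in> A" "w \<in> D" using wl by (auto simp: A_def D_def)
        have "kelvin l w powr p - u w powr p \<le> p * kelvin l w powr (p - 1) * (kelvin l w - u w)"
          using False up p_gt_1 by (intro powr_diff_le) auto
        also have "\<dots> \<le> p * m powr (p - 1) * g y"
          using False p_gt_1 kel[OF wl] y(2)[OF wA(2)]
          by (intro mult_mono powr_mono2) (auto simp: g_def)
        finally have "kelvin l w powr p - u w powr p \<le> c" by (simp add: c_def)
        then have "kelvin_kernel a x l y w * (kelvin l w powr p - u w powr p) \<le> norm (y - w) powr (- a) * c"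
          using mult_left_mono[OF _ K] mult_right_mono[OF kelvin_kernel_le c, of a x l y w]
          by (meson order_trans)
        then show ?thesis using wA(1) by (simp add: algebra_simps)
      qed
    qed (use small in auto)
    finally have lower: "- (c * (LINT w:A|lebesgue. norm (y - w) powr (- a)))
      \<le> (LINT w:ring l|lebesgue. kelvin_kernel a x l y w * (u w powr p - kelvin l w powr p))" .
    \<comment> \<open>The threshold in \<open>thin\<close> was chosen to make the loss at most
      \<open>g y / 2\<close>, so \<open>g y \<le> g y / 2\<close> at a positive maximum.\<close>
    have "c * (LINT w:A|lebesgue. norm (y - w) powr (- a)) \<le> c * (1 / (2 * p * m powr (p - 1)))"
      using thin(2)[of y] c by (intro mult_left_mono) (auto simp: A_def)
    also have "\<dots> = g y / 2" using m p_gt_1 by (simp add: c_def)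
    finally have "c * (LINT w:A|lebesgue. norm (y - w) powr (- a)) \<le> g y / 2" .
    moreover have "l / norm (y - x) \<le> 1"
      using yl l(1) by (subst divide_le_eq_1_pos) (auto intro: less_trans)
    then have "(l / norm (y - x)) powr (a / 2) \<le> 1"
      using l a by (intro powr_le1) auto
    then have "0 \<le> c0 / 2 * (1 - (l / norm (y - x)) powr (a / 2))" using c0(1) by simp
    ultimately have "g y \<le> g y / 2"
      using ki(2)[OF _ yS] small lower by (simp add: g_def)
    then show False using gy by simp
  qed
qed

text \<open>Continuity method on the infimum \<open>s\<close> of the bad radii: small radii are
  good, \<open>s\<close> is good by passage to the limit, and so are all radii slightly beyond
  \<open>s\<close>. The strict bound \<open>l < l1\<close> keeps closed balls off \<Sigma> even if
  the ball of radius \<open>l1\<close> touches it.\<close>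

lemma moving_spheres:
  assumes l1: "0 < l1" "l1 \<le> \<rho> / 4" and disj: "ball x l1 \<inter> \<Sigma> = {}"
    and small: "\<And>w. w \<in> cball x (l1 / 2) \<Longrightarrow> l1 powr a * u w \<le> \<epsilon>"
    and l: "0 < l" "l < l1"
  shows "dominated l"
proof (rule ccontr)
  assume notdom: "\<not> dominated l"
  have sub: "cball x R \<inter> \<Sigma> = {}" "cball x R \<subseteq> \<Omega> - \<Sigma>" if "R < l1" for R
  proof -
    have "cball x R \<subseteq> ball x l1" "cball x R \<subseteq> cball x \<rho>" using that l1 rho by auto
    then show "cball x R \<inter> \<Sigma> = {}" "cball x R \<subseteq> \<Omega> - \<Sigma>" using disj cball_sub by auto
  qed
  have small': "t powr a * u w \<le> \<epsilon>" if t: "0 < t" "t < l1" and w: "w \<in> cball x (t / 2)" for t w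
  proof -
    have "cball x (t / 2) \<subseteq> cball x (l1 / 2)" using t by (intro subset_cball) auto
    then have w1: "w \<in> cball x (l1 / 2)" using w by auto
    then have "0 < u w" using sub(2)[of "l1 / 2"] l1 by (intro u_pos) auto
    then have "t powr a * u w \<le> l1 powr a * u w"
      using t a by (intro mult_right_mono powr_mono2) auto
    then show ?thesis using small[OF w1] by simp
  qed
  have inner: "t\<^sup>2 / \<rho> \<le> t / 2" if "0 < t" "t < l1" for t
    using that l1 by (simp add: field_simps power2_eq_square)
  have small2: "t powr a * u w \<le> \<epsilon>" if t: "0 < t" "t < l1" and w: "w \<in> cball x (t\<^sup>2 / \<rho>)" for t w
    using small'[OF t] w subset_cball[OF inner[OF t], of x] by auto
  \<comment> \<open>From distance \<open>\<rho> / 2\<close> on, reflected points are within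
    \<open>t / 2\<close> of the centre, so the smallness hypothesis alone gives
    \<open>kelvin t y \<le> c0 \<le> h y \<le> u y\<close>.\<close>
  have far: "kelvin t y \<le> u y"
    if t: "0 < t" "t < l1" and y: "y \<in> ball x \<rho> - \<Sigma>" "\<rho> / 2 \<le> norm (y - x)" for t y
  proof -
    define Y where "Y = norm (y - x)"
    have Y: "0 < Y" "\<rho> / 2 \<le> Y" using y rho by (auto simp: Y_def)
    have "t\<^sup>2 / Y \<le> t\<^sup>2 / (\<rho> / 2)" using Y rho by (intro divide_left_mono) auto
    also have "\<dots> \<le> t / 2" using t l1 rho by (simp add: field_simps power2_eq_square)
    finally have in_cball: "inversion x t y \<in> cball x (t / 2)"
      using norm_inversion_center[of x t y] by (simp add: dist_norm norm_minus_commute Y_def)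
    then have le: "t powr a * u (inversion x t y) \<le> \<epsilon>" by (rule small'[OF t])
    have "1 / Y \<le> 2 / \<rho>" using Y rho by (simp add: field_simps)
    then have "(1 / Y) powr a \<le> (2 / \<rho>) powr a"
      using Y a by (intro powr_mono2) auto
    then have "(1 / Y) powr a * (t powr a * u (inversion x t y)) \<le> (2 / \<rho>) powr a * \<epsilon>"
      using eps(1) mult_left_mono[OF le, of "(1 / Y) powr a"]
      by (auto intro: order_trans mult_right_mono)
    moreover have "kelvin t y = (1 / Y) powr a * (t powr a * u (inversion x t y))"
      by (simp add: kelvin_def Y_def powr_divide)
    ultimately have "kelvin t y \<le> c0" using eps(2) by simp
    also have "\<dots> \<le> h y" using c0(2) y by simp
    also have "\<dots> \<le> u y" using y cball_sub by (intro h_le_u) auto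
    finally show ?thesis .
  qed
  have thin: "\<exists>\<delta>>0. \<forall>G\<in>sets borel. emeasure lborel G \<le> ennreal \<delta> \<longrightarrow>
    (\<forall>y::real^'n. set_integrable lebesgue G (\<lambda>w. norm (y - w) powr (- a)) \<and>
       (LINT w:G|lebesgue. norm (y - w) powr (- a)) \<le> 1 / (2 * p * m powr (p - 1)))" if "0 < m" for m
    using that p_gt_1 a by (intro riesz_potential_small) auto
  define T where "T = {t. 0 < t \<and> t < l1 \<and> \<not> dominated t}"
  have lT: "l \<in> T" using l notdom by (simp add: T_def)
  define s where "s = Inf T"
  have bdd: "bdd_below T" by (auto simp: T_def intro: bdd_belowI[of _ 0])
  have s_le: "s \<le> t" if "t \<in> T" for t unfolding s_def by (rule cInf_lower[OF that bdd])
  have s_ge: "c \<le> s" if "\<And>t. t \<in> T \<Longrightarrow> c \<le> t" for c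
    unfolding s_def by (rule cInf_greatest) (use lT that in auto)
  have "0 < s"
  proof -
    obtain m where m: "0 < m" "\<And>w. w \<in> cball x (l1 / 2) \<Longrightarrow> u w \<le> m"
      using cball_bounded_above[of x "l1 / 2"] sub[of "l1 / 2"] l1 by auto
    obtain \<delta> where \<delta>0: "0 < \<delta>" and \<delta>1: "\<forall>G\<in>sets borel. emeasure lborel G \<le> ennreal \<delta> \<longrightarrow>
    (\<forall>y::real^'n. set_integrable lebesgue G (\<lambda>w. norm (y - w) powr (- a)) \<and>
       (LINT w:G|lebesgue. norm (y - w) powr (- a)) \<le> 1 / (2 * p * m powr (p - 1)))"
      using thin[OF m(1)] by (elim exE conjE)
    note \<delta> = \<delta>0 \<delta>1[rule_format]
    have "((\<lambda>r. unit_ball_vol CARD('n) * r ^ CARD('n)) \<longlongrightarrow> unit_ball_vol CARD('n) * 0 ^ CARD('n)) (at_right 0)"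
      by (intro tendsto_intros)
    then have "\<forall>\<^sub>F r in at_right 0. unit_ball_vol CARD('n) * r ^ CARD('n) < \<delta>"
      by (rule order_tendstoD(2)) (use \<delta>(1) in \<open>simp add: zero_power\<close>)
    moreover have "\<forall>\<^sub>F r in at_right (0::real). r \<in> {0<..<l1 / 2}"
      using l1 by (intro eventually_at_right_real) simp
    ultimately have "\<forall>\<^sub>F r in at_right 0. unit_ball_vol CARD('n) * r ^ CARD('n) < \<delta> \<and> r < l1 / 2 \<and> 0 < r"
      by eventually_elim auto
    then obtain r where r: "unit_ball_vol CARD('n) * r ^ CARD('n) < \<delta>" "r < l1 / 2" "0 < r"
      using eventually_happens trivial_limit_at_right_real by blast
    \<comment> \<open>Outside radius \<open>r\<close> this forces
      \<open>(t / |y - x|) powr a * m \<le> c0 \<le> h y\<close>; inside, the annulus is contained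
      in a ball of volume less than \<open>\<delta>\<close>.\<close>
    define c where "c = min r (r * (c0 / m) powr (1 / a))"
    have c: "0 < c" using r c0 m by (simp add: c_def)
    have "dominated t" if t: "0 < t" "t < c" for t
    proof (rule dominated_if_outside[where R = r and m = m])
      have tr: "t < r" using t by (simp add: c_def)
      show "t < r" "r < \<rho> / 2" "0 < t" using tr r l1 t by auto
      show "cball x r \<inter> \<Sigma> = {}" using sub(1)[of r] r by simp
      show "t powr a * u w \<le> \<epsilon>" if "w \<in> cball x (t\<^sup>2 / \<rho>)" for w
        using small2[of t w] that t tr r by simp
      show "0 < m" by (rule m(1))
      show "u w \<le> m" if "w \<in> cball x t" for w
        using m(2)[of w] that tr r by simp
      let ?A = "{w. t \<le> norm (w - x) \<and> norm (w - x) < r}"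
      have "emeasure lborel ?A \<le> emeasure lborel (ball x r)"
        by (rule emeasure_mono) (auto simp: dist_norm norm_minus_commute)
      also have "\<dots> \<le> ennreal \<delta>" using r by (simp add: emeasure_ball ennreal_leI)
      finally have "emeasure lborel ?A \<le> ennreal \<delta>" .
      note * = \<delta>(2)[OF _ this]
      show "set_integrable lebesgue ?A (\<lambda>w. norm (y - w) powr (- a))" for y using * by auto
      show "(LINT w:?A|lebesgue. norm (y - w) powr (- a)) \<le> 1 / (2 * p * m powr (p - 1))" for y
        using * by auto
      show "kelvin t y \<le> u y" if y: "y \<in> ball x \<rho> - \<Sigma>" "r \<le> norm (y - x)" for y
      proof -
        define Y where "Y = norm (y - x)"
        have Y: "0 < Y" "r \<le> Y" using y r by (auto simp: Y_def)
        have "t\<^sup>2 / Y \<le> t\<^sup>2 / r" using Y r by (intro divide_left_mono) auto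
        also have "\<dots> \<le> t"
          using t tr r by (simp add: pos_divide_le_eq power2_eq_square mult_left_mono)
        also have "\<dots> \<le> l1 / 2" using tr r by simp
        finally have "inversion x t y \<in> cball x (l1 / 2)"
          using norm_inversion_center[of x t y] by (simp add: dist_norm norm_minus_commute Y_def)
        then have um: "u (inversion x t y) \<le> m" "0 < u (inversion x t y)"
          using m(2) sub(2)[of "l1 / 2"] l1 by (auto intro!: u_pos)
        have "t / Y \<le> (c0 / m) powr (1 / a)"
        proof -
          have "t / Y \<le> t / r" using Y r t by (intro divide_left_mono) auto
          also have "\<dots> \<le> (c0 / m) powr (1 / a)"
            using t r by (simp add: c_def field_simps)
          finally show ?thesis .
        qed
        then have "(t / Y) powr a \<le> ((c0 / m) powr (1 / a)) powr a"
          using t Y a by (intro powr_mono2) auto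
        also have "\<dots> = c0 / m" using a c0 m by (simp add: powr_powr)
        finally have "kelvin t y \<le> c0 / m * m"
          unfolding kelvin_def Y_def[symmetric] using um m c0(1) by (intro mult_mono) auto
        also have "\<dots> \<le> h y" using c0(2)[of y] y m by simp
        also have "\<dots> \<le> u y" using y cball_sub by (intro h_le_u) auto
        finally show ?thesis .
      qed
    qed
    then have "c \<le> s" by (intro s_ge) (force simp: T_def)
    then show ?thesis using c by simp
  qed
  have "s \<le> l" using s_le[OF lT] .
  then have sl1: "s < l1" using l by simp
  have below: "dominated t" if "0 < t" "t < s" for t
    using s_le[of t] that sl1 by (force simp: T_def)
  have dom_s: "dominated s"
    unfolding dominated_def
  proof (intro ballI impI)
    fix y assume y: "y \<in> ball x \<rho> - \<Sigma>" "s \<le> norm (y - x)"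
    have "0 < norm (y - x)" using y \<open>0 < s\<close> by linarith
    then have "s\<^sup>2 / norm (y - x) \<le> s"
      using y \<open>0 < s\<close> by (simp add: field_simps power2_eq_square)
    then have "inversion x s y \<in> cball x s"
      using norm_inversion_center[of x s y] by (simp add: dist_norm norm_minus_commute)
    then have ins: "inversion x s y \<in> \<Omega> - \<Sigma>" using sub(2)[OF sl1] by auto
    have "isCont u (inversion x s y)"
      using cont ins open_domain closed_sing by (simp add: continuous_on_eq_continuous_at open_Diff)
    moreover have "((\<lambda>t. inversion x t y) \<longlongrightarrow> inversion x s y) (at_left s)"
      unfolding inversion_def using \<open>0 < norm (y - x)\<close> by (intro tendsto_intros) auto
    ultimately have "((\<lambda>t. u (inversion x t y)) \<longlongrightarrow> u (inversion x s y)) (at_left s)"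
      by (rule isCont_tendsto_compose)
    then have "((\<lambda>t. kelvin t y) \<longlongrightarrow> kelvin s y) (at_left s)"
      unfolding kelvin_def using \<open>0 < norm (y - x)\<close> \<open>0 < s\<close> by (intro tendsto_intros) auto
    moreover have "\<forall>\<^sub>F t in at_left s. kelvin t y \<le> u y"
      using eventually_at_left_real[OF \<open>0 < s\<close>]
      by eventually_elim (use below y in \<open>auto simp: dominated_def\<close>)
    ultimately show "kelvin s y \<le> u y"
      by (rule tendsto_upperbound) simp
  qed
  \<comment> \<open>Fixing a radius between \<open>s\<close> and \<open>l1\<close> fixes
    \<open>m\<close>, hence \<open>\<delta>\<close>, before \<open>R\<close> is moved close enough
    to \<open>s\<close>.\<close>
  define R0 where "R0 = (s + l1) / 2"
  have R0: "s < R0" "R0 < l1" using sl1 by (auto simp: R0_def)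
  obtain m where m: "0 < m" "\<And>w. w \<in> cball x R0 \<Longrightarrow> u w \<le> m"
    using cball_bounded_above[of x R0] sub[of R0] R0 by auto
  obtain \<delta> where \<delta>0: "0 < \<delta>" and \<delta>1: "\<forall>G\<in>sets borel. emeasure lborel G \<le> ennreal \<delta> \<longrightarrow>
    (\<forall>y::real^'n. set_integrable lebesgue G (\<lambda>w. norm (y - w) powr (- a)) \<and>
       (LINT w:G|lebesgue. norm (y - w) powr (- a)) \<le> 1 / (2 * p * m powr (p - 1)))"
    using thin[OF m(1)] by (elim exE conjE)
  note \<delta> = \<delta>0 \<delta>1[rule_format]
  have "((\<lambda>r. unit_ball_vol CARD('n) * r ^ CARD('n)) \<longlongrightarrow> unit_ball_vol CARD('n) * s ^ CARD('n)) (at_right s)"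
    by (intro tendsto_intros)
  then have "\<forall>\<^sub>F r in at_right s. unit_ball_vol CARD('n) * r ^ CARD('n) < unit_ball_vol CARD('n) * s ^ CARD('n) + \<delta>"
    by (rule order_tendstoD(2)) (use \<delta>(1) in \<open>simp add: zero_power\<close>)
  then have "\<forall>\<^sub>F r in at_right s. unit_ball_vol CARD('n) * r ^ CARD('n) < unit_ball_vol CARD('n) * s ^ CARD('n) + \<delta>
      \<and> s < r \<and> r < R0"
    using eventually_at_right_real[OF R0(1)] by eventually_elim auto
  then obtain R where R: "unit_ball_vol CARD('n) * R ^ CARD('n) < unit_ball_vol CARD('n) * s ^ CARD('n) + \<delta>"
      "s < R" "R < R0"
    using eventually_happens trivial_limit_at_right_real by blast
  have R\<rho>: "R < l1" "R < \<rho> / 2" "R \<le> \<rho>" using R R0 l1 rho by auto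
  \<comment> \<open>A lower bound for the strict gap at radius \<open>s\<close> for all
    \<open>y\<close> with \<open>R \<le> |y - x| < \<rho> / 2\<close>. Uniform continuity keeps the
    change of the Kelvin transform below it.\<close>
  define \<kappa> where "\<kappa> = c0 / 2 * (1 - (s / R) powr (a / 2))"
  have "(s / R) powr (a / 2) < 1 powr (a / 2)"
    using \<open>0 < s\<close> R a by (intro powr_less_mono2) auto
  then have \<kappa>: "0 < \<kappa>" using c0 by (simp add: \<kappa>_def)
  let ?C = "{s..R} \<times> {y. R \<le> norm (y - x) \<and> norm (y - x) \<le> \<rho>}"
  define \<Phi> where "\<Phi> = (\<lambda>(t, y). kelvin t y)"
  have uc: "uniformly_continuous_on ?C \<Phi>"
    unfolding \<Phi>_def
  proof (rule compact_uniformly_continuous)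
    show "continuous_on ?C (\<lambda>(t, y). kelvin t y)"
      using kelvin_continuous[of s R] \<open>0 < s\<close> R R\<rho> sub(1)[of R]
      by (auto intro: continuous_on_subset)
    have "{y. R \<le> norm (y - x) \<and> norm (y - x) \<le> \<rho>} = cball x \<rho> - ball x R"
      by (auto simp: dist_norm norm_minus_commute)
    then show "compact ?C" by (simp add: compact_Times compact_diff)
  qed
  obtain d where d: "0 < d" "\<forall>z\<in>?C. \<forall>z'\<in>?C. dist z' z < d \<longrightarrow> dist (\<Phi> z') (\<Phi> z) < \<kappa>"
    using uc[unfolded uniformly_continuous_on_def, THEN spec, THEN mp, OF \<kappa>] by (elim exE conjE)
  have "dominated t" if t: "s \<le> t" "t < min R (s + d)" for t
  proof (rule dominated_if_outside[where R = R and m = m])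
    have t0: "0 < t" "t < R" "t < l1" using t \<open>0 < s\<close> R\<rho> by auto
    show "0 < t" "t < R" "R < \<rho> / 2" "0 < m" using t0 R\<rho> m by auto
    show "cball x R \<inter> \<Sigma> = {}" using sub(1) R\<rho> by simp
    show "t powr a * u w \<le> \<epsilon>" if "w \<in> cball x (t\<^sup>2 / \<rho>)" for w
      using small2[of t w] that t0 by simp
    show "u w \<le> m" if "w \<in> cball x t" for w
      using m(2)[of w] that t0 R by simp
    let ?A = "{w. t \<le> norm (w - x) \<and> norm (w - x) < R}"
    have "emeasure lborel ?A \<le> emeasure lborel (ball x R - ball x s)"
      by (rule emeasure_mono) (use t in \<open>auto simp: dist_norm norm_minus_commute\<close>)
    also have "\<dots> = emeasure lborel (ball x R) - emeasure lborel (ball x s)"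
      using R by (intro emeasure_Diff) (auto simp: emeasure_ball \<open>0 < s\<close> less_imp_le)
    also have "\<dots> = ennreal (unit_ball_vol CARD('n) * R ^ CARD('n) - unit_ball_vol CARD('n) * s ^ CARD('n))"
      using R \<open>0 < s\<close> by (simp add: emeasure_ball ennreal_minus)
    also have "\<dots> \<le> ennreal \<delta>" using R by (intro ennreal_leI) simp
    finally have "emeasure lborel ?A \<le> ennreal \<delta>" .
    note * = \<delta>(2)[OF _ this]
    show "set_integrable lebesgue ?A (\<lambda>w. norm (y - w) powr (- a))" for y using * by auto
    show "(LINT w:?A|lebesgue. norm (y - w) powr (- a)) \<le> 1 / (2 * p * m powr (p - 1))" for y
      using * by auto
    show "kelvin t y \<le> u y" if y: "y \<in> ball x \<rho> - \<Sigma>" "R \<le> norm (y - x)" for y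
    proof (cases "norm (y - x) < \<rho> / 2")
      case True
      have "kelvin s y + c0 / 2 * (1 - (s / norm (y - x)) powr (a / 2)) \<le> u y"
        using \<open>0 < s\<close> sub(1)[OF sl1] small2[OF \<open>0 < s\<close> sl1] dom_s y R True
        by (intro dominated_strict) auto
      moreover have "(s / norm (y - x)) powr (a / 2) \<le> (s / R) powr (a / 2)"
        using \<open>0 < s\<close> R y a by (intro powr_mono2 frac_le) auto
      then have "\<kappa> \<le> c0 / 2 * (1 - (s / norm (y - x)) powr (a / 2))"
        using c0 by (simp add: \<kappa>_def)
      moreover have "dist (kelvin t y) (kelvin s y) < \<kappa>"
      proof -
        have "dist (t, y) (s, y) < d" using t by (simp add: dist_prod_def dist_real_def)
        then show ?thesis
          using bspec[OF bspec[OF d(2)], of "(s, y)" "(t, y)"] t t0 y True R rho by (simp add: \<Phi>_def)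
      qed
      ultimately show ?thesis by (simp add: dist_real_def)
    next
      case False
      then show ?thesis using far[OF t0(1,3) y(1)] by simp
    qed
  qed
  then have "min R (s + d) \<le> s"
    by (intro s_ge) (metis (mono_tags, lifting) T_def mem_Collect_eq not_less s_le)
  then show False using R d by auto
qed

end

section \<open>Upper bound near the singular set\<close>

text \<open>The centre lies on the line through \<open>y2\<close> and \<open>y1\<close>, beyond
  \<open>y1\<close>. The two distances multiply to \<open>l^2\<close>, so the inversion exchanges
  the points.\<close>

lemma inversion_on_ray:
  fixes y1 y2 :: "'a::real_inner"
  assumes "y1 \<noteq> y2" "0 < b"
  defines "\<tau> \<equiv> norm (y1 - y2)"
  defines "x \<equiv> y1 + (b / \<tau>) *\<^sub>R (y1 - y2)"
  shows "norm (y1 - x) = b" "norm (y2 - x) = b + \<tau>" "inversion x (sqrt (b * (b + \<tau>))) y2 = y1"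
proof -
  have \<tau>: "0 < \<tau>" using assms by (simp add: \<tau>_def)
  have "y1 - x = - ((b / \<tau>) *\<^sub>R (y1 - y2))" by (simp add: x_def)
  then have "norm (y1 - x) = (b / \<tau>) * \<tau>" using \<tau> assms(2) by (simp add: \<tau>_def)
  then show "norm (y1 - x) = b" using \<tau> by simp
  have y2: "y2 - x = - ((b + \<tau>) / \<tau>) *\<^sub>R (y1 - y2)"
    using \<tau> by (simp add: x_def add_divide_distrib algebra_simps)
  have "norm (y2 - x) = ((b + \<tau>) / \<tau>) * \<tau>"
    unfolding y2 norm_scaleR \<tau>_def[symmetric] using \<tau> assms(2) by simp
  then show n: "norm (y2 - x) = b + \<tau>" using \<tau> by simp
  have "(sqrt (b * (b + \<tau>)))\<^sup>2 / (norm (y2 - x))\<^sup>2 = b / (b + \<tau>)"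
    using \<tau> assms(2) unfolding n by (simp add: power2_eq_square)
  then have "inversion x (sqrt (b * (b + \<tau>))) y2 = x + (b / (b + \<tau>)) *\<^sub>R (y2 - x)"
    by (simp add: inversion_def)
  also have "(b / (b + \<tau>)) *\<^sub>R (y2 - x) = - ((b / \<tau>) *\<^sub>R (y1 - y2))"
    unfolding y2 using \<tau> assms(2) by simp
  also have "x + - ((b / \<tau>) *\<^sub>R (y1 - y2)) = y1" by (simp add: x_def)
  finally show "inversion x (sqrt (b * (b + \<tau>))) y2 = y1" .
qed

text \<open>The radius, in units of the intrinsic length, at which the lower bound
  \<open>2 powr (- (a / 2)) * m\<close> on a ball already forces a potential of \<open>2 * m\<close>
  at its centre.\<close>

definition blowup_scale :: "real \<Rightarrow> real \<Rightarrow> real \<Rightarrow> real" where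
  "blowup_scale a p n = (2 * 2 powr (a * p / 2) / unit_ball_vol n) powr (1 / (n - a))"

lemma blowup_scale_pos:
  assumes "0 \<le> n"
  shows "0 < blowup_scale a p n"
  using less_imp_neq[OF unit_ball_vol_pos[OF assms]] by (simp add: blowup_scale_def)

lemma blowup_scale:
  assumes "0 \<le> n" "a < n"
  shows "2 powr (- (a * p / 2)) * unit_ball_vol n * blowup_scale a p n powr (n - a) = 2"
  using assms less_imp_neq[OF unit_ball_vol_pos[OF assms(1)]]
  by (simp add: blowup_scale_def powr_powr powr_minus)

text \<open>The centre depends on the pair of points compared, so one choice of constants has to
  serve all centres in \<open>X\<close>.\<close>

locale uniform_moving_sphere = singular_solution a p \<Sigma> \<Omega> u h
  for a p :: real and \<Sigma> \<Omega> :: "(real^'n) set" and u h :: "real^'n \<Rightarrow> real" +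
  fixes X :: "(real^'n) set" and \<rho> c0 M \<epsilon> :: real
  assumes center: "\<And>x. x \<in> X \<Longrightarrow> moving_sphere a p \<Sigma> \<Omega> u h x \<rho> c0 M \<epsilon>"
    and rho_pos: "0 < \<rho>"
begin

text \<open>Domination at \<open>y2\<close> reads
  \<open>(l / (b + \<tau>)) powr a * u y1 \<le> u y2\<close>; since
  \<open>l^2 = b * (b + \<tau>)\<close>, the square of the ratio is \<open>b / (b + \<tau>)\<close>,
  which halves the exponent.\<close>

lemma compare_on_ray:
  assumes y: "y1 \<noteq> y2" "y2 \<notin> \<Sigma>" and b: "0 < b"
  defines "\<tau> \<equiv> norm (y1 - y2)"
  defines "x \<equiv> y1 + (b / \<tau>) *\<^sub>R (y1 - y2)"
  assumes x: "x \<in> X" and l1: "sqrt (b * (b + \<tau>)) < l1" "l1 \<le> \<rho> / 4" "b + \<tau> < \<rho>"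
    and disj: "ball x l1 \<inter> \<Sigma> = {}"
    and small: "\<And>w. w \<in> cball x (l1 / 2) \<Longrightarrow> l1 powr a * u w \<le> \<epsilon>"
  shows "(b / (b + \<tau>)) powr (a / 2) * u y1 \<le> u y2"
proof -
  interpret moving_sphere a p \<Sigma> \<Omega> u h x \<rho> c0 M \<epsilon> by (rule center[OF x])
  have \<tau>: "0 < \<tau>" using y by (simp add: \<tau>_def)
  define l where "l = sqrt (b * (b + \<tau>))"
  note ray = inversion_on_ray[OF y(1) b, folded \<tau>_def, folded x_def]
  have l: "0 < l" using b \<tau> by (simp add: l_def)
  have "l \<le> sqrt ((b + \<tau>)\<^sup>2)"
    unfolding l_def using b \<tau> by (intro real_sqrt_le_mono) (simp add: power2_eq_square mult_right_mono)
  then have "l \<le> norm (y2 - x)" using b \<tau> ray by simp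
  moreover have "dominated l"
  proof (rule moving_spheres[of l1])
    show "l < l1" using l1 by (simp add: l_def)
    then show "0 < l1" using l by simp
  qed (use l l1 disj small in auto)
  moreover have "y2 \<in> ball x \<rho> - \<Sigma>"
    using y ray l1 by (simp add: dist_norm norm_minus_commute)
  ultimately have "kelvin l y2 \<le> u y2" by (simp add: dominated_def)
  moreover have "(l / (b + \<tau>)) powr a = (b / (b + \<tau>)) powr (a / 2)"
  proof -
    have "(l / (b + \<tau>))\<^sup>2 = b / (b + \<tau>)"
      using b \<tau> by (simp add: l_def power_divide power2_eq_square)
    then have "l / (b + \<tau>) = (b / (b + \<tau>)) powr (1 / 2)"
      using l b \<tau> by (simp add: powr_half_sqrt real_sqrt_unique)
    then show ?thesis by (simp add: powr_powr)
  qed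
  ultimately show ?thesis
    using ray by (simp add: kelvin_def l_def)
qed

text \<open>If the bound fails, then by the doubling argument \<open>u\<close> is almost maximal at some \<open>y1\<close> on a ball that
  is large compared with the intrinsic length \<open>l\<close>. Moving spheres centred near \<open>y1\<close> make \<open>u\<close> comparable
  to \<open>u y1\<close> on the ball of radius \<open>L * l\<close>, and the integral equation at \<open>y1\<close> then overshoots.\<close>

lemma singular_upper_bound:
  fixes w0 :: "real^'n" and d :: real
  assumes d: "0 < d" "d \<le> \<rho>" "(blowup_scale a p CARD('n) * d) powr (a / 2) \<le> \<epsilon>"
    and disj: "ball w0 d \<inter> \<Sigma> = {}" and sub: "ball w0 d \<subseteq> X \<inter> \<Omega>"
  shows "u w0 \<le> (8 * blowup_scale a p CARD('n) / d) powr (a / 2)"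
proof -
  define L where "L = blowup_scale a p CARD('n)"
  have L: "0 < L" using blowup_scale_pos[of "CARD('n)" a p] by (simp add: L_def)
  have ball_ok: "w \<in> \<Omega> - \<Sigma>" "w \<in> X" if "dist w0 w < d" for w
    using that disj sub by auto
  \<comment> \<open>Maximizing this weighted function is the doubling argument in one step: the
    weight vanishes on the boundary sphere, so the maximum is interior.\<close>
  define f where "f y = u y * (d / 2 - norm (y - w0)) powr (a / 2)" for y
  have "continuous_on (cball w0 (d / 2)) u"
    using ball_ok d by (intro continuous_on_subset[OF cont]) auto
  then have "continuous_on (cball w0 (d / 2)) f"
    unfolding f_def[abs_def] using a
    by (intro continuous_intros continuous_on_powr') (auto simp: dist_norm norm_minus_commute)
  moreover have "w0 \<in> cball w0 (d / 2)" using d by simp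
  ultimately obtain y1 where y1: "y1 \<in> cball w0 (d / 2)" "\<And>y. y \<in> cball w0 (d / 2) \<Longrightarrow> f y \<le> f y1"
    using continuous_attains_sup[OF compact_cball, of w0 "d / 2" f] by blast
  \<comment> \<open>Half of the weight's base at \<open>y1\<close>: within distance \<open>s\<close>
    of \<open>y1\<close> the base is still at least \<open>s\<close>, which bounds \<open>u\<close>
    by \<open>2 powr (a / 2) * m\<close>.\<close>
  define s where "s = (d / 2 - norm (y1 - w0)) / 2"
  define m where "m = u y1"
  have y1_in: "y1 \<in> \<Omega> - \<Sigma>" using y1 d by (intro ball_ok) auto
  then have m: "0 < m" unfolding m_def by (rule u_pos)
  have w0_pos: "0 < u w0" using d by (intro u_pos ball_ok) auto
  have f0: "u w0 * (d / 2) powr (a / 2) \<le> m * (2 * s) powr (a / 2)"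
  proof -
    have "f w0 \<le> f y1" using y1(2)[of w0] d by simp
    moreover have "2 * s = d / 2 - norm (y1 - w0)" by (simp add: s_def)
    then have "f y1 = m * (2 * s) powr (a / 2)" by (simp only: f_def m_def)
    ultimately show ?thesis by (simp add: f_def)
  qed
  have s0: "0 \<le> s" using y1(1) by (simp add: s_def dist_norm norm_minus_commute)
  have s: "0 < s"
  proof (rule ccontr)
    assume "\<not> 0 < s"
    then have "s = 0" using s0 by simp
    then have "u w0 * (d / 2) powr (a / 2) \<le> 0" using f0 by simp
    moreover have "0 < u w0 * (d / 2) powr (a / 2)" using w0_pos d by simp
    ultimately show False by simp
  qed
  have dist_y1: "dist w0 y1 = d / 2 - 2 * s" by (simp add: s_def dist_norm norm_minus_commute field_simps)
  have s_le: "s \<le> d / 4" using zero_le_dist[of w0 y1] dist_y1 by linarith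
  have near: "u y \<le> 2 powr (a / 2) * m" if y: "dist y1 y \<le> s" for y
  proof -
    have tri: "dist w0 y \<le> d / 2 - s" using dist_triangle[of w0 y y1] y dist_y1 by simp
    then have "dist w0 y \<le> d / 2" using s by simp
    then have "f y \<le> f y1" using y1(2) by simp
    also have "f y1 = m * (2 * s) powr (a / 2)"
    proof -
      have "2 * s = d / 2 - norm (y1 - w0)" by (simp add: s_def)
      then show ?thesis by (simp only: f_def m_def)
    qed
    also have "\<dots> = 2 powr (a / 2) * m * s powr (a / 2)" using s by (simp add: powr_mult)
    finally have 1: "f y \<le> 2 powr (a / 2) * m * s powr (a / 2)" .
    have "s powr (a / 2) \<le> (d / 2 - norm (y - w0)) powr (a / 2)"
      using tri s a by (intro powr_mono2) (auto simp: dist_norm norm_minus_commute)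
    moreover have "0 < u y" using tri s d by (intro u_pos ball_ok) auto
    ultimately have "u y * s powr (a / 2) \<le> f y" unfolding f_def by (intro mult_left_mono) auto
    then have "u y * s powr (a / 2) \<le> 2 powr (a / 2) * m * s powr (a / 2)" using 1 by simp
    then show ?thesis using s by simp
  qed
  define l where "l = m powr (- 2 / a)"
  have l: "0 < l" using m by (simp add: l_def)
  have la: "m * l powr (a / 2) = 1" 
  proof -
    have "l powr (a / 2) = m powr (- 1)"
      unfolding l_def powr_powr using a by simp
    then show ?thesis using m by (simp add: powr_minus)
  qed
  have "s < 2 * L * l"
  proof (rule ccontr)
    assume "\<not> s < 2 * L * l"
    then have sl: "2 * L * l \<le> s" by simp
    \<comment> \<open>The sphere is centred at distance \<open>b = L * l\<close> beyond
      \<open>y1\<close>; \<open>\<tau> < b\<close> makes the comparison factor at least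
      \<open>(1 / 2) powr (a / 2)\<close>.\<close>
    have lower: "2 powr (- (a / 2)) * m \<le> u y" if y: "dist y1 y < L * l" for y
    proof (cases "y = y1")
      case True
      have "2 powr (- (a / 2)) \<le> 2 powr 0" using a by (intro powr_mono) auto
      then show ?thesis using True m mult_right_mono[of "2 powr (- (a / 2))" 1 m] by (simp add: m_def)
    next
      case False
      define b where "b = L * l"
      define \<tau> where "\<tau> = norm (y1 - y)"
      define x where "x = y1 + (b / \<tau>) *\<^sub>R (y1 - y)"
      have b: "0 < b" using L l by (simp add: b_def)
      have \<tau>: "0 < \<tau>" "\<tau> < b" using False y by (auto simp: \<tau>_def b_def dist_norm)
      have bs: "2 * b \<le> s" using sl by (simp add: b_def mult.assoc)
      have yx: "dist y1 x = b"
        using inversion_on_ray(1)[of y1 y b] False b by (simp add: x_def \<tau>_def dist_norm)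
      have x_ball: "dist w0 v < d" if "dist x v \<le> 2 * b" for v
        using dist_triangle[of w0 v x] dist_triangle[of w0 x y1] yx dist_y1 that bs s s_le by linarith
      have "(b / (b + \<tau>)) powr (a / 2) * u y1 \<le> u y"
        unfolding \<tau>_def
      proof (rule compare_on_ray[where ?l1.0 = "2 * b"], fold \<tau>_def, fold x_def)
        show "y1 \<noteq> y" "0 < b" using False b by auto
        have "dist w0 y < d" using dist_triangle[of w0 y y1] y dist_y1 bs s s_le by (simp add: b_def)
        then show "y \<notin> \<Sigma>" using ball_ok by blast
        show "x \<in> X" using x_ball[of x] b by (intro ball_ok) auto
        have "sqrt (b * (b + \<tau>)) < sqrt ((2 * b)\<^sup>2)"
        proof (rule real_sqrt_less_mono)
          have "b * (b + \<tau>) < b * (b + b)" using b \<tau> by (intro mult_strict_left_mono) auto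
          also have "\<dots> \<le> (2 * b)\<^sup>2" by (simp add: power2_eq_square)
          finally show "b * (b + \<tau>) < (2 * b)\<^sup>2" .
        qed
        also have "\<dots> = 2 * b" using b by (intro real_sqrt_unique) auto
        finally show "sqrt (b * (b + \<tau>)) < 2 * b" .
        show "2 * b \<le> \<rho> / 4" "b + \<tau> < \<rho>" using bs s_le d \<tau> b by linarith+
        show "ball x (2 * b) \<inter> \<Sigma> = {}" using x_ball ball_ok by fastforce
        show "(2 * b) powr a * u w \<le> \<epsilon>" if w: "w \<in> cball x (2 * b / 2)" for w
        proof -
          have "dist y1 w \<le> s" using dist_triangle[of y1 w x] yx w bs by simp
          then have "(2 * b) powr a * u w \<le> (2 * b) powr a * (2 powr (a / 2) * m)"
            by (intro mult_left_mono near) auto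
          \<comment> \<open>One factor \<open>l\<close> is split off to use
            \<open>m * l powr (a / 2) = 1\<close>. What remains is at most \<open>L * d\<close>,
            since \<open>2 * L * l \<le> s \<le> d / 4\<close>.\<close>
          also have "\<dots> = (L * (8 * L * l)) powr (a / 2) * (m * l powr (a / 2))"
          proof -
            have "(2 * b) powr a = ((2 * b) * (2 * b)) powr (a / 2)"
              using b by (simp add: powr_mult flip: powr_add)
            moreover have "((2 * b) * (2 * b)) powr (a / 2) * 2 powr (a / 2) = ((L * (8 * L * l)) * l) powr (a / 2)"
              by (simp add: b_def mult_ac flip: powr_mult)
            moreover have "((L * (8 * L * l)) * l) powr (a / 2) = (L * (8 * L * l)) powr (a / 2) * l powr (a / 2)"
              by (rule powr_mult)
            ultimately show ?thesis by (simp add: mult_ac)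
          qed
          also have "\<dots> \<le> (L * d) powr (a / 2)"
          proof -
            have "8 * L * l \<le> d" using sl s_le by simp
            then show ?thesis unfolding la using L l a by (simp add: powr_mono2 mult_left_mono)
          qed
          finally show ?thesis using d(3) by (simp add: L_def)
        qed
      qed
      moreover have "2 powr (- (a / 2)) \<le> (b / (b + \<tau>)) powr (a / 2)"
      proof -
        have "1 / 2 \<le> b / (b + \<tau>)" using b \<tau> by (simp add: field_simps)
        then have "(1 / 2) powr (a / 2) \<le> (b / (b + \<tau>)) powr (a / 2)"
          using a by (intro powr_mono2) auto
        moreover have "(1 / 2 :: real) powr (a / 2) = 2 powr (- (a / 2))"
          unfolding powr_divide powr_minus_divide by simp
        ultimately show ?thesis by simp
      qed
      then have "2 powr (- (a / 2)) * m \<le> (b / (b + \<tau>)) powr (a / 2) * m"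
        using m by (intro mult_right_mono) auto
      ultimately show ?thesis by (simp add: m_def)
    qed
    define B where "B = ball y1 (L * l)"
    define c where "c = (2 powr (- (a / 2)) * m) powr p * (L * l) powr (- a)"
    have Bsub: "B \<subseteq> \<Omega>"
    proof
      fix w assume "w \<in> B"
      then have "dist w0 w < d"
        using dist_triangle[of w0 w y1] dist_y1 sl s s_le L l by (simp add: B_def)
      then show "w \<in> \<Omega>" using ball_ok by blast
    qed
    have fin: "B \<in> lmeasurable" by (simp add: B_def)
    then have ci: "set_integrable lebesgue B (\<lambda>v. c)"
      by (rule absolutely_integrable_on_const)
    have Bleb: "B \<in> sets lebesgue" using fin by (simp add: fmeasurableD)
    have Oleb: "\<Omega> - B \<in> sets lebesgue" using open_domain Bleb by auto
    note I = dist_power_integrable[OF y1_in]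
    have "c * measure lebesgue B = (LINT v:B|lebesgue. c)"
      using fin by (simp add: set_lebesgue_integral_def)
    also have "\<dots> \<le> (LINT v:B|lebesgue. u v powr p * norm (y1 - v) powr (- a))"
    proof (rule set_integral_mono_off_negligible[of _ _ _ "{y1}"])
      show "set_integrable lebesgue B (\<lambda>v. u v powr p * norm (y1 - v) powr (- a))"
        by (rule set_integrable_subset[OF I Bleb Bsub])
      fix v assume v: "v \<in> B" "v \<notin> {y1}"
      have "(2 powr (- (a / 2)) * m) powr p \<le> u v powr p"
        using lower[of v] v m p_gt_1 by (intro powr_mono2) (auto simp: B_def)
      moreover have "(L * l) powr (- a) \<le> norm (y1 - v) powr (- a)"
        using v a by (intro powr_mono2') (auto simp: B_def dist_norm)
      ultimately show "c \<le> u v powr p * norm (y1 - v) powr (- a)"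
        unfolding c_def by (intro mult_mono) auto
    qed (use ci in auto)
    also have "\<dots> \<le> (LINT v:B|lebesgue. u v powr p * norm (y1 - v) powr (- a))
        + (LINT v:\<Omega> - B|lebesgue. u v powr p * norm (y1 - v) powr (- a))"
      using set_integral_nonneg_off_negligible[of "{}" "\<Omega> - B" "\<lambda>v. u v powr p * norm (y1 - v) powr (- a)"] by simp
    also have "\<dots> = (LINT v:B \<union> (\<Omega> - B)|lebesgue. u v powr p * norm (y1 - v) powr (- a))"
      using set_integrable_subset[OF I Bleb Bsub] set_integrable_subset[OF I Oleb]
      by (intro set_integral_Un[symmetric]) auto
    also have "B \<union> (\<Omega> - B) = \<Omega>" using Bsub by auto
    also have "(LINT v:\<Omega>|lebesgue. u v powr p * norm (y1 - v) powr (- a)) < m"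
      using u_eq[OF y1_in] h_pos[of y1] y1_in by (simp add: m_def)
    finally have "c * measure lebesgue B < m" .
    moreover have "c * measure lebesgue B = 2 * m"
    proof -
      have "measure lebesgue B = unit_ball_vol CARD('n) * (L * l) powr CARD('n)"
        using L l by (simp add: B_def content_ball powr_realpow)
      then have "c * measure lebesgue B = (2 powr (- (a / 2))) powr p * m powr p * unit_ball_vol CARD('n)
          * ((L * l) powr (- a) * (L * l) powr CARD('n))"
        by (simp add: c_def powr_mult)
      also have "(L * l) powr (- a) * (L * l) powr CARD('n) = L powr (CARD('n) - a) * l powr (CARD('n) - a)"
        using powr_add[of "L * l" "- a" "CARD('n)"] by (simp add: powr_mult)
      also have "(2 powr (- (a / 2))) powr p = 2 powr (- (a * p / 2))"
        by (simp add: powr_powr)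
      \<comment> \<open>Criticality again: the intrinsic length turns \<open>m powr p\<close> from
        the integrand into exactly \<open>m\<close>.\<close>
      also have "l powr (CARD('n) - a) = m powr (1 - p)"
      proof -
        have "- 2 / a * (CARD('n) - a) = 1 - p"
          using a ap by (simp add: field_simps)
        then show ?thesis by (simp add: l_def powr_powr)
      qed
      finally have "c * measure lebesgue B = (2 powr (- (a * p / 2)) * unit_ball_vol CARD('n) * L powr (CARD('n) - a))
          * (m powr p * m powr (1 - p))"
        by simp
      also have "m powr p * m powr (1 - p) = m" using m by (simp flip: powr_add)
      finally show ?thesis unfolding L_def by (simp add: blowup_scale a(2))
    qed
    ultimately show False using m by simp
  qed
  then have "(2 * s) powr (a / 2) \<le> (4 * L * l) powr (a / 2)"
    using s a by (intro powr_mono2) auto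
  then have "m * (2 * s) powr (a / 2) \<le> m * ((4 * L) powr (a / 2) * l powr (a / 2))"
    using m by (simp flip: powr_mult)
  then have "u w0 * (d / 2) powr (a / 2) \<le> (4 * L) powr (a / 2) * (m * l powr (a / 2))"
    using f0 by (simp add: mult_ac)
  then have "u w0 \<le> (4 * L) powr (a / 2) / (d / 2) powr (a / 2)"
    using la d by (simp add: field_simps)
  also have "\<dots> = (8 * L / d) powr (a / 2)"
    by (simp flip: powr_divide)
  finally show ?thesis by (simp add: L_def)
qed

text \<open>Admissibility of the sphere up to \<open>D = |x - z|\<close> comes from
  \<open>singular_upper_bound\<close> on balls of radius \<open>D / 2\<close> around points of
  \<open>cball x (D / 2)\<close>. It gives
  \<open>D powr a * u \<le> (16 * L * D) powr (a / 2)\<close>, where \<open>L\<close> is the blowup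
  scale.\<close>

lemma fibre_comparison:
  fixes z x1 x2 :: "real^'n" and r b D0 :: real
  assumes z: "z \<in> \<Sigma>" and x12: "norm (x1 - z) = r" "norm (x2 - z) = r" "x1 \<noteq> x2" "x2 \<notin> \<Sigma>"
    and r: "0 < r" "0 < b" "r + b \<le> D0"
    and D0: "D0 \<le> \<rho> / 4" "(16 * blowup_scale a p CARD('n) * D0) powr (a / 2) \<le> \<epsilon>" "ball z (3 * D0) \<subseteq> X \<inter> \<Omega>"
  defines "\<tau> \<equiv> norm (x1 - x2)"
  defines "x \<equiv> x1 + (b / \<tau>) *\<^sub>R (x1 - x2)"
  assumes disj: "ball x (norm (x - z)) \<inter> \<Sigma> = {}"
  shows "(b / (b + \<tau>)) powr (a / 2) * u x1 \<le> u x2"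
proof -
  define D where "D = norm (x - z)"
  have \<tau>: "0 < \<tau>" using x12 by (simp add: \<tau>_def)
  define p1 where "p1 = x1 - z"
  define p2 where "p2 = x2 - z"
  have n12: "p1 \<bullet> p1 = r\<^sup>2" "p2 \<bullet> p2 = r\<^sup>2"
    using x12 by (auto simp: p1_def p2_def dot_square_norm)
  have tsq: "\<tau>\<^sup>2 = 2 * r\<^sup>2 - 2 * (p1 \<bullet> p2)"
  proof -
    have "x1 - x2 = p1 - p2" by (simp add: p1_def p2_def)
    then have "\<tau>\<^sup>2 = (p1 - p2) \<bullet> (p1 - p2)" by (simp add: \<tau>_def dot_square_norm)
    then show ?thesis using n12 by (simp add: inner_diff_left inner_diff_right inner_commute)
  qed
  \<comment> \<open>Equal distances to \<open>z\<close> give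
    \<open>2 * (p1 \<bullet> (p1 - p2)) = \<tau>^2\<close>, the cross term of the square. Since
    \<open>r > 0\<close>, the sphere radius is strictly below \<open>D\<close>.\<close>
  have Dsq: "D\<^sup>2 = r\<^sup>2 + b * (b + \<tau>)"
  proof -
    define v where "v = p1 - p2"
    have vv: "v \<bullet> v = \<tau>\<^sup>2" by (simp add: v_def p1_def p2_def \<tau>_def dot_square_norm)
    have pv: "2 * (p1 \<bullet> v) = \<tau>\<^sup>2" using tsq n12 by (simp add: v_def inner_diff_right)
    have "x - z = p1 + (b / \<tau>) *\<^sub>R v" by (simp add: x_def p1_def p2_def v_def)
    then have "D\<^sup>2 = (p1 + (b / \<tau>) *\<^sub>R v) \<bullet> (p1 + (b / \<tau>) *\<^sub>R v)"
      by (simp add: D_def dot_square_norm)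
    also have "\<dots> = p1 \<bullet> p1 + (b / \<tau>) * (2 * (p1 \<bullet> v)) + (b / \<tau>)\<^sup>2 * (v \<bullet> v)"
      by (simp add: inner_commute algebra_simps power2_eq_square)
    also have "\<dots> = r\<^sup>2 + b * (b + \<tau>)"
      unfolding n12 pv vv using \<tau> by (simp add: field_simps power2_eq_square)
    finally show ?thesis .
  qed
  have D_pos: "0 < D"
  proof -
    have "0 < D\<^sup>2" unfolding Dsq using r \<tau> by (intro add_pos_pos mult_pos_pos) auto
    then show ?thesis by (simp add: D_def)
  qed
  have "D \<le> b + r"
  proof -
    have "norm (x1 - x) = b" using inversion_on_ray(1)[of x1 x2 b] x12 r by (simp add: x_def \<tau>_def)
    then show ?thesis using norm_triangle_ineq[of "x - x1" "x1 - z"] x12 by (simp add: D_def norm_minus_commute)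
  qed
  then have DD0: "D \<le> D0" using r by simp
  have "r\<^sup>2 \<le> D\<^sup>2" "b\<^sup>2 \<le> D\<^sup>2" using Dsq r \<tau> by (auto simp: power2_eq_square algebra_simps)
  then have rD: "r \<le> D" "b \<le> D" using D_pos r by (auto intro: power2_le_imp_le)
  have "\<tau> \<le> 2 * r"
    using norm_triangle_ineq4[of "x1 - z" "x2 - z"] x12 by (simp add: \<tau>_def)
  have zx: "dist z x = D" by (simp add: D_def dist_norm norm_minus_commute)
  have near: "dist z w \<le> 3 / 2 * D" if "dist x w \<le> D / 2" for w
    using dist_triangle[of z w x] zx that by simp
  show ?thesis
    unfolding \<tau>_def
  proof (rule compare_on_ray[where ?l1.0 = D], fold \<tau>_def, fold x_def)
    show "x1 \<noteq> x2" "x2 \<notin> \<Sigma>" "0 < b" using x12 r by auto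
    have "x \<in> ball z (3 * D0)" using zx DD0 D_pos by simp
    then show "x \<in> X" using D0(3) by blast
    have "sqrt (b * (b + \<tau>)) < sqrt (D\<^sup>2)" using Dsq r by (intro real_sqrt_less_mono) simp
    also have "\<dots> = D" using D_pos by (intro real_sqrt_unique) auto
    finally show "sqrt (b * (b + \<tau>)) < D" .
    show "D \<le> \<rho> / 4" "b + \<tau> < \<rho>" using DD0 D0(1) rD \<open>\<tau> \<le> 2 * r\<close> rho_pos by linarith+
    show "ball x D \<inter> \<Sigma> = {}" using disj by (simp add: D_def)
    show "D powr a * u w \<le> \<epsilon>" if w: "w \<in> cball x (D / 2)" for w
    proof -
      have wb: "ball w (D / 2) \<subseteq> ball x D"
      proof
        fix v assume "v \<in> ball w (D / 2)"
        then show "v \<in> ball x D" using w dist_triangle[of x v w] by simp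
      qed
      have "u w \<le> (8 * blowup_scale a p CARD('n) / (D / 2)) powr (a / 2)"
      proof (rule singular_upper_bound)
        show "0 < D / 2" "D / 2 \<le> \<rho>" using D_pos DD0 D0(1) rho_pos by linarith+
        have "(blowup_scale a p CARD('n) * (D / 2)) powr (a / 2) \<le> (16 * blowup_scale a p CARD('n) * D0) powr (a / 2)"
        proof -
          have "blowup_scale a p CARD('n) * (D / 2) \<le> blowup_scale a p CARD('n) * (16 * D0)"
            using D_pos DD0 blowup_scale_pos[of "CARD('n)" a p] by (intro mult_left_mono) auto
          then show ?thesis using a D_pos blowup_scale_pos[of "CARD('n)" a p] by (intro powr_mono2) (auto simp: mult_ac)
        qed
        then show "(blowup_scale a p CARD('n) * (D / 2)) powr (a / 2) \<le> \<epsilon>" using D0(2) by simp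
        show "ball w (D / 2) \<inter> \<Sigma> = {}" using wb disj by (auto simp: D_def)
        have "ball x D \<subseteq> ball z (3 * D0)"
        proof
          fix v assume "v \<in> ball x D"
          then show "v \<in> ball z (3 * D0)" using dist_triangle[of z v x] zx DD0 D_pos by simp
        qed
        then show "ball w (D / 2) \<subseteq> X \<inter> \<Omega>" using wb D0(3) by blast
      qed
      then have "D powr a * u w \<le> D powr a * (16 * blowup_scale a p CARD('n) / D) powr (a / 2)"
        by (intro mult_left_mono) (auto simp: field_simps)
      also have "D powr a * (16 * blowup_scale a p CARD('n) / D) powr (a / 2)
          = (D * D) powr (a / 2) * (16 * blowup_scale a p CARD('n) / D) powr (a / 2)"
        using D_pos by (simp add: powr_mult flip: powr_add)
      also have "(D * D) powr (a / 2) * (16 * blowup_scale a p CARD('n) / D) powr (a / 2) = (16 * blowup_scale a p CARD('n) * D) powr (a / 2)"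
        using D_pos by (simp add: mult_ac flip: powr_mult)
      also have "\<dots> \<le> (16 * blowup_scale a p CARD('n) * D0) powr (a / 2)"
        using a D_pos DD0 blowup_scale_pos[of "CARD('n)" a p] by (intro powr_mono2 mult_left_mono) auto
      finally show ?thesis using D0(2) by simp
    qed
  qed
qed

end

section \<open>Tubular neighborhoods\<close>

lemma smooth_on_imp_differentiable_on:
  assumes "smooth_on f S"
  shows "f differentiable_on S"
proof -
  have "Ck_on (Suc 0) f S" using assms by (simp only: smooth_on_def)
  then show ?thesis
    by (auto simp: differentiable_on_def intro: differentiable_at_withinI)
qed

text \<open>In a chart the set is the image of part of a proper subspace under a differentiable map,
  hence null; being null is a local property.\<close>

lemma negligible_smooth_submanifold:
  fixes S :: "'a::euclidean_space set"
  assumes "smooth_submanifold k S" "k < DIM('a)"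
  shows "negligible S"
proof (subst locally_negligible_alt, rule ballI)
  fix p assume p: "p \<in> S"
  from bspec[OF assms(1)[unfolded smooth_submanifold_def] p]
  obtain U W L :: "'a set" and \<phi> \<psi> :: "'a \<Rightarrow> 'a" where
    chart: "open U" "p \<in> U" "homeomorphism U W \<phi> \<psi>" "smooth_on \<psi> W"
      "dim L = k" "\<phi> ` (U \<inter> S) = W \<inter> L"
    by (elim exE conjE)
  have "negligible L" using chart(5) assms(2) by (intro negligible_lowdim) simp
  then have "negligible (W \<inter> L)" by (rule negligible_subset) simp
  then have "negligible (\<psi> ` (W \<inter> L))"
    using smooth_on_imp_differentiable_on[OF chart(4)]
    by (intro negligible_differentiable_image_negligible) (auto intro: differentiable_on_subset)
  moreover have "U \<inter> S \<subseteq> \<psi> ` (W \<inter> L)"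
    unfolding chart(6)[symmetric] using chart(3) by (force simp: homeomorphism_def image_image)
  ultimately have "negligible (U \<inter> S)" by (rule negligible_subset)
  moreover have "openin (top_of_set S) (U \<inter> S)"
    using chart(1) by (simp add: openin_open_Int inf_commute)
  ultimately show "\<exists>U. openin (top_of_set S) U \<and> p \<in> U \<and> negligible U"
    using p chart(2) by blast
qed

text \<open>First variation: along every curve in \<open>S\<close> through \<open>y\<close> the
  squared distance to \<open>w\<close> is minimal at time 0.\<close>

lemma nearest_point_normal:
  fixes S :: "'a::euclidean_space set"
  assumes y: "y \<in> S" and near: "\<And>q. q \<in> S \<Longrightarrow> norm (w - y) \<le> norm (w - q)"
  shows "w - y \<in> orthogonal_comp (tangent_space S y)"
  unfolding orthogonal_comp_def
proof (intro CollectI ballI)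
  fix t assume "t \<in> tangent_space S y"
  then obtain \<gamma> :: "real \<Rightarrow> 'a" and e where \<gamma>: "e > 0" "\<gamma> ` {-e<..<e} \<subseteq> S" "\<gamma> 0 = y"
      "(\<gamma> has_vector_derivative t) (at 0)"
    unfolding tangent_space_def by blast
  let ?f = "\<lambda>s. (w - \<gamma> s) \<bullet> (w - \<gamma> s)"
  have "(?f has_real_derivative - 2 * ((w - y) \<bullet> t)) (at 0)"
    unfolding has_field_derivative_def
    by (rule derivative_eq_intros \<gamma>(4)[unfolded has_vector_derivative_def] refl)+
      (auto simp: \<gamma>(3) fun_eq_iff inner_commute algebra_simps)
  moreover have "?f 0 \<le> ?f s" if "\<bar>0 - s\<bar> < e" for s
  proof -
    have "s \<in> {-e<..<e}" using that by auto
    then have "\<gamma> s \<in> S" using \<gamma>(2) by blast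
    then have "(norm (w - y))\<^sup>2 \<le> (norm (w - \<gamma> s))\<^sup>2" using near by (intro power_mono) auto
    then show ?thesis by (simp add: \<gamma>(3) power2_norm_eq_inner)
  qed
  ultimately have "- 2 * ((w - y) \<bullet> t) = 0"
    using \<gamma>(1) by (intro DERIV_local_min[of ?f _ 0 e]) auto
  then show "orthogonal t (w - y)" by (simp add: orthogonal_def inner_commute)
qed

text \<open>The nearest point to \<open>z + v\<close> also has it on its normal space, so injectivity of the addition
  map forces that point to be \<open>z\<close>.\<close>

lemma tubular_neighborhood_reach:
  fixes S :: "'a::euclidean_space set"
  assumes "compact S" "tubular_neighborhood S N P"
  shows "\<exists>\<delta>>0. \<forall>z\<in>S. \<forall>v\<in>orthogonal_comp (tangent_space S z). norm v < \<delta> \<longrightarrow>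
    ball (z + v) (norm v) \<inter> S = {}"
proof -
  obtain V where V: "openin (top_of_set (normal_bundle S)) V" "\<And>x. x \<in> S \<Longrightarrow> (x, 0) \<in> V"
      "bij_betw (\<lambda>(x, v). x + v) V N"
    using assms(2) unfolding tubular_neighborhood_def by blast
  obtain T where T: "open T" "V = normal_bundle S \<inter> T"
    using V(1) unfolding openin_open by blast
  have "compact (S \<times> {0::'a})" using assms(1) by (simp add: compact_Times)
  moreover have "S \<times> {0} \<subseteq> T" using V(2) T(2) by auto
  \<comment> \<open>Compactness of the zero section yields one length below which all normal vectors
    belong to \<open>V\<close>.\<close>
  ultimately obtain \<delta> where \<delta>: "0 < \<delta>" "(\<Union>q\<in>S \<times> {0}. ball q \<delta>) \<subseteq> T"
    using compact_subset_open_imp_ball_epsilon_subset[OF _ T(1)] by blast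
  have in_V: "(x, v) \<in> V" if "x \<in> S" "v \<in> orthogonal_comp (tangent_space S x)" "norm v < \<delta>" for x v
  proof -
    have "(x, v) \<in> ball (x, 0) \<delta>" using that(3) by (simp add: dist_prod_def)
    then have "(x, v) \<in> T" using \<delta>(2) that(1) by blast
    then show ?thesis using that T(2) by (simp add: normal_bundle_def)
  qed
  have "ball (z + v) (norm v) \<inter> S = {}"
    if z: "z \<in> S" and v: "v \<in> orthogonal_comp (tangent_space S z)" "norm v < \<delta>" for z v
  proof (rule ccontr)
    assume "ball (z + v) (norm v) \<inter> S \<noteq> {}"
    then obtain q where q: "q \<in> S" "dist (z + v) q < norm v" by auto
    obtain y where y: "y \<in> S" "\<And>q. q \<in> S \<Longrightarrow> dist (z + v) y \<le> dist (z + v) q"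
      using distance_attains_inf[of S "z + v"] compact_imp_closed[OF assms(1)] z by blast
    have less: "norm (z + v - y) < norm v" using y(2)[OF q(1)] q(2) by (simp add: dist_norm)
    have "(y, z + v - y) \<in> V"
      using y less v(2) by (intro in_V nearest_point_normal) (auto simp: dist_norm)
    moreover have "(z, v) \<in> V" by (intro in_V z v)
    ultimately have "(y, z + v - y) = (z, v)"
      by (rule inj_onD[OF bij_betw_imp_inj_on[OF V(3)], rotated]) simp
    then have "y = z" by (rule Pair_inject)
    with less show False by simp
  qed
  then show ?thesis using \<delta>(1) by blast
qed

text \<open>Every point of \<open>N\<close> is \<open>x + v\<close> with \<open>(x, v)\<close> in
  \<open>V\<close>, and the projection identifies \<open>x\<close> as \<open>z\<close>.\<close>

lemma fibre_sphere_normal: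
  assumes "tubular_neighborhood S N P" "y \<in> fibre_sphere N P r z"
  shows "z \<in> S" "y - z \<in> orthogonal_comp (tangent_space S z)" "norm (y - z) = r"
proof -
  obtain V where V: "openin (top_of_set (normal_bundle S)) V"
      "bij_betw (\<lambda>(x, v). x + v) V N" "\<And>x v. (x, v) \<in> V \<Longrightarrow> P (x + v) = x"
    using assms(1) unfolding tubular_neighborhood_def by blast
  have y: "y \<in> N" "P y = z" "norm (y - z) = r"
    using assms(2) by (auto simp: fibre_sphere_def)
  obtain x v where xv: "(x, v) \<in> V" "y = x + v"
    using y(1) bij_betw_imp_surj_on[OF V(2)] by auto
  have "x = z" using V(3)[OF xv(1)] y(2) xv(2) by simp
  moreover have "(x, v) \<in> normal_bundle S"
    using openin_imp_subset[OF V(1)] xv(1) by blast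
  ultimately show "z \<in> S" "y - z \<in> orthogonal_comp (tangent_space S z)" "norm (y - z) = r"
    using xv(2) y(3) by (auto simp: normal_bundle_def)
qed

section \<open>Positive C^1 functions on compact convex sets\<close>

text \<open>\<open>Ck_on\<close> gives continuity of each directional derivative separately;
  bounding them over the finite basis bounds the operator norm, and convexity allows the mean value
  inequality.\<close>

lemma Ck_on_1_lipschitz:
  fixes f :: "'a::euclidean_space \<Rightarrow> real"
  assumes f: "Ck_on 1 f S" and Q: "compact Q" "convex Q" "Q \<subseteq> S"
  obtains B where "0 \<le> B" "\<And>y y'. y \<in> Q \<Longrightarrow> y' \<in> Q \<Longrightarrow> \<bar>f y - f y'\<bar> \<le> B * norm (y - y')"
proof -
  let ?D = "\<lambda>x. frechet_derivative f (at x)"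
  have diff: "f differentiable (at x)" if "x \<in> S" for x using f that by simp
  have cont: "continuous_on S (\<lambda>x. ?D x v)" for v using f by simp
  have "\<forall>b. \<exists>C. \<forall>x\<in>Q. \<bar>?D x b\<bar> \<le> C"
  proof
    fix b
    have "compact ((\<lambda>x. ?D x b) ` Q)"
      using continuous_on_subset[OF cont Q(3)] Q(1) by (rule compact_continuous_image)
    then obtain C where "\<forall>t\<in>(\<lambda>x. ?D x b) ` Q. \<bar>t\<bar> \<le> C"
      using compact_imp_bounded bounded_real by blast
    then show "\<exists>C. \<forall>x\<in>Q. \<bar>?D x b\<bar> \<le> C" by auto
  qed
  from choice[OF this] obtain C where C: "\<forall>b. \<forall>x\<in>Q. \<bar>?D x b\<bar> \<le> C b" ..
  define B where "B = (\<Sum>b\<in>Basis. \<bar>C b\<bar>)"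
  have onorm: "onorm (?D x) \<le> B" if x: "x \<in> Q" for x
  proof (rule onorm_le)
    fix v
    have lin: "linear (?D x)"
      using diff[of x] x Q(3) frechet_derivative_works has_derivative_linear by blast
    have "?D x v = ?D x (\<Sum>b\<in>Basis. (v \<bullet> b) *\<^sub>R b)" by (simp add: euclidean_representation)
    also have "\<dots> = (\<Sum>b\<in>Basis. (v \<bullet> b) * ?D x b)"
      by (simp add: linear_sum[OF lin] linear_cmul[OF lin])
    finally have "norm (?D x v) \<le> (\<Sum>b\<in>Basis. \<bar>(v \<bullet> b) * ?D x b\<bar>)"
      by simp
    also have "\<dots> \<le> (\<Sum>b\<in>Basis. norm v * \<bar>C b\<bar>)"
    proof (rule sum_mono)
      fix b :: 'a assume b: "b \<in> Basis"
      have "\<bar>?D x b\<bar> \<le> \<bar>C b\<bar>" using C[rule_format, OF x, of b] by linarith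
      then show "\<bar>(v \<bullet> b) * ?D x b\<bar> \<le> norm v * \<bar>C b\<bar>"
        unfolding abs_mult using Basis_le_norm[OF b, of v] by (intro mult_mono) auto
    qed
    finally show "norm (?D x v) \<le> B * norm v" by (simp add: B_def sum_distrib_left mult.commute)
  qed
  have "norm (f y - f y') \<le> B * norm (y - y')" if "y \<in> Q" "y' \<in> Q" for y y'
  proof (rule differentiable_bound[OF Q(2) _ onorm that(1) that(2)])
    fix x assume "x \<in> Q"
    then have "(f has_derivative ?D x) (at x)"
      using diff[of x] Q(3) frechet_derivative_works by blast
    then show "(f has_derivative ?D x) (at x within Q)" by (rule has_derivative_at_withinI)
  qed
  moreover have "0 \<le> B" by (simp add: B_def sum_nonneg)
  ultimately show thesis using that by auto
qed

text \<open>With minimum \<open>c\<close> and Lipschitz constant \<open>B\<close>, the constant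
  \<open>M = B / c\<close> works because \<open>1 + t \<le> exp t\<close>.\<close>

lemma positive_C1_log_lipschitz:
  fixes f :: "'a::euclidean_space \<Rightarrow> real"
  assumes f: "Ck_on 1 f S" "\<And>x. x \<in> S \<Longrightarrow> 0 < f x"
    and Q: "compact Q" "convex Q" "Q \<subseteq> S" "Q \<noteq> {}"
  obtains c M where "0 < c" "0 \<le> M" "\<And>y. y \<in> Q \<Longrightarrow> c \<le> f y"
    "\<And>y y'. y \<in> Q \<Longrightarrow> y' \<in> Q \<Longrightarrow> f y \<le> f y' * exp (M * norm (y - y'))"
proof -
  have "continuous_on S f"
    using f(1) by (auto intro!: continuous_at_imp_continuous_on differentiable_imp_continuous_within)
  then have "continuous_on Q f" using Q(3) by (rule continuous_on_subset)
  then obtain q where q: "q \<in> Q" "\<And>y. y \<in> Q \<Longrightarrow> f q \<le> f y"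
    using continuous_attains_inf[OF Q(1,4)] by blast
  obtain B where B: "0 \<le> B" "\<And>y y'. y \<in> Q \<Longrightarrow> y' \<in> Q \<Longrightarrow> \<bar>f y - f y'\<bar> \<le> B * norm (y - y')"
    using Ck_on_1_lipschitz[OF f(1) Q(1-3)] by metis
  have c: "0 < f q" using q Q(3) f(2) by auto
  have "f y \<le> f y' * exp (B / f q * norm (y - y'))" if y: "y \<in> Q" "y' \<in> Q" for y y'
  proof -
    have "f y \<le> f y' + B * norm (y - y')" using B(2)[OF y] by linarith
    also have "B * norm (y - y') = f q * (B / f q * norm (y - y'))" using c by simp
    also have "\<dots> \<le> f y' * (B / f q * norm (y - y'))"
      using q(2)[OF y(2)] B(1) c by (intro mult_right_mono) auto
    also have "f y' + f y' * (B / f q * norm (y - y')) = f y' * (1 + B / f q * norm (y - y'))"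
      by (simp add: algebra_simps)
    also have "\<dots> \<le> f y' * exp (B / f q * norm (y - y'))"
      using q(2)[OF y(2)] c by (intro mult_left_mono exp_ge_add_one_self) auto
    finally show ?thesis by simp
  qed
  then show thesis using that[of "f q" "B / f q"] c B(1) q(2) by simp
qed

section \<open>Comparison on fibre spheres\<close>

lemma exp_close_to_1:
  fixes t q :: real
  assumes "0 \<le> t" "t \<le> 1" "exp (- t) \<le> q" "q \<le> exp t"
  shows "\<bar>q - 1\<bar> \<le> 2 * t"
proof -
  have "exp t \<le> 1 + t + t\<^sup>2" using assms by (intro exp_bound) auto
  moreover have "t\<^sup>2 \<le> t" using assms by (simp add: power2_eq_square mult_left_le)
  moreover have "1 - t \<le> exp (- t)" using exp_ge_add_one_self[of "- t"] by simp
  ultimately show ?thesis using assms by linarith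
qed

theorem theorem1p6:
  fixes \<sigma> :: real and k :: nat
    and \<Sigma> N A :: "(real ^ 'n) set"
    and P :: "real ^ 'n \<Rightarrow> real ^ 'n"
    and h u :: "real ^ 'n \<Rightarrow> real"
  assumes "0 < \<sigma>" and "\<sigma> < real CARD('n) / 2"
    and "closed_manifold k \<Sigma>" and "k \<le> CARD('n) - 1"
    and "tubular_neighborhood \<Sigma> N P"
    and "Ck_on 1 h (ball 0 2)" and "\<forall>x\<in>ball 0 2. h x > 0"
    and "in_Lp ((real CARD('n) + 2 * \<sigma>) / (real CARD('n) - 2 * \<sigma>)) (ball 0 2) u"
    and "continuous_on (ball 0 2 - \<Sigma>) u"
    and "\<forall>x\<in>ball 0 2 - \<Sigma>. u x > 0"
    and "\<forall>x\<in>ball 0 2 - \<Sigma>.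
           set_integrable lebesgue (ball 0 2)
             (\<lambda>y. u y powr ((real CARD('n) + 2 * \<sigma>) / (real CARD('n) - 2 * \<sigma>))
                    / norm (x - y) powr (real CARD('n) - 2 * \<sigma>)) \<and>
           u x = (LINT y:ball 0 2|lebesgue.
                    u y powr ((real CARD('n) + 2 * \<sigma>) / (real CARD('n) - 2 * \<sigma>))
                      / norm (x - y) powr (real CARD('n) - 2 * \<sigma>)) + h x"
    and "compact A" and "A \<subseteq> \<Sigma>" and "A \<subseteq> ball 0 2"
  shows "\<exists>C>0. \<exists>r0>0. \<forall>r. 0 < r \<and> r < r0 \<longrightarrow>
           (\<forall>z\<in>A. \<forall>x\<in>fibre_sphere N P r z. \<forall>x'\<in>fibre_sphere N P r z.
              \<bar>u x / u x' - 1\<bar> \<le> C * r)"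
proof (cases "A = {}")
  case True
  then show ?thesis by (intro exI[of _ "1 :: real"] conjI) auto
next
  case False
  define a where "a = real CARD('n) - 2 * \<sigma>"
  define p where "p = (real CARD('n) + 2 * \<sigma>) / a"
  define \<Omega> where "\<Omega> = ball (0 :: real^'n) 2"
  have a: "0 < a" "a < real CARD('n)" using assms(1,2) by (auto simp: a_def)
  have ap: "a * p = 2 * CARD('n) - a" using a by (simp add: p_def) (simp add: a_def)
  have p: "0 < p" using a assms(1) by (simp add: p_def)
  have closed_mf: "compact \<Sigma>" "smooth_submanifold k \<Sigma>"
    using assms(3) by (auto simp: closed_manifold_def)
  have "k < CARD('n)" using assms(4) zero_less_card_finite[where 'a = 'n] by linarith
  then have "k < DIM(real^'n)" by simp
  then have negl: "negligible \<Sigma>" by (rule negligible_smooth_submanifold[OF closed_mf(2)])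
  interpret singular_solution a p \<Sigma> \<Omega> u h
  proof
    show "0 < a" "a < real CARD('n)" "a * p = 2 * CARD('n) - a" by (fact a ap)+
    show "closed \<Sigma>" using closed_mf(1) by (rule compact_imp_closed)
    show "open \<Omega>" "negligible \<Sigma>" using negl by (simp_all add: \<Omega>_def)
    show "continuous_on (\<Omega> - \<Sigma>) u" using assms(9) by (simp add: \<Omega>_def)
    show "0 < h x" if "x \<in> \<Omega>" for x using assms(7) that by (simp add: \<Omega>_def)
    show "set_integrable lebesgue \<Omega> (\<lambda>y. u y powr p / norm (x - y) powr a)"
      "u x = (LINT y:\<Omega>|lebesgue. u y powr p / norm (x - y) powr a) + h x"
      if "x \<in> \<Omega> - \<Sigma>" for x
      using bspec[OF assms(11), of x] that unfolding p_def a_def \<Omega>_def by simp_all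
  qed
  obtain z0 where z0: "z0 \<in> A" "\<And>z. z \<in> A \<Longrightarrow> norm z \<le> norm z0"
    using continuous_attains_sup[OF assms(12) False continuous_on_norm_id] by auto
  define R where "R = norm z0"
  \<comment> \<open>Nested balls: \<open>A\<close> has norm at most \<open>R\<close>, centres at
    most \<open>(R + R') / 2\<close>, and spheres of radius \<open>\<rho>\<close> around centres
    stay in \<open>Q\<close>, a compact subset of \<open>ball 0 2\<close>.\<close>
  define R' where "R' = (R + 2) / 2"
  have R: "R < R'" "R' < 2" using z0(1) assms(14) by (auto simp: R_def R'_def)
  define Q where "Q = cball (0 :: real^'n) R'"
  have "0 \<le> R" by (simp add: R_def)
  then have Q: "compact Q" "convex Q" "Q \<subseteq> ball 0 2" "Q \<noteq> {}" using R by (auto simp: Q_def)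
  have h_pos': "\<And>x. x \<in> ball 0 2 \<Longrightarrow> 0 < h x" using assms(7) by blast
  obtain c0 M where c0: "0 < c0" and M: "0 \<le> M" and c0_le: "\<And>y. y \<in> Q \<Longrightarrow> c0 \<le> h y"
    and h_lip: "\<And>y y'. y \<in> Q \<Longrightarrow> y' \<in> Q \<Longrightarrow> h y \<le> h y' * exp (M * norm (y - y'))"
    by (rule positive_C1_log_lipschitz[OF assms(6) h_pos' Q]) blast+
  \<comment> \<open>Strictly positive, so that it can be divided by even when
    \<open>M = 0\<close>.\<close>
  define M1 where "M1 = M + 1"
  have M1: "0 < M1" "M \<le> M1" using M by (auto simp: M1_def)
  define \<rho> where "\<rho> = min ((R' - R) / 2) (a / (2 * M1))"
  have \<rho>: "0 < \<rho>" "\<rho> \<le> (R' - R) / 2"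
    using R a M1 by (simp add: \<rho>_def) (simp only: \<rho>_def min.cobounded1)
  have "M * \<rho> \<le> M1 * (a / (2 * M1))"
    using M M1 \<rho> by (intro mult_mono) (auto simp: \<rho>_def)
  also have "\<dots> = a / 2" using M1 by simp
  finally have M\<rho>: "2 * M * \<rho> \<le> a" by simp
  define K where "K = 6 * 2 powr a * unit_ball_vol CARD('n) / \<rho> ^ CARD('n)"
  have "0 < unit_ball_vol (real CARD('n))" by (rule unit_ball_vol_pos) simp
  then have K: "0 < K" using \<rho>(1) unfolding K_def by (intro divide_pos_pos mult_pos_pos) auto
  define \<epsilon> where "\<epsilon> = min (c0 * (\<rho> / 2) powr a) ((c0 / (2 * K)) powr (1 / p))"
  have \<epsilon>: "0 < \<epsilon>" using c0 \<rho>(1) K by (simp add: \<epsilon>_def)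
  have "(2 / \<rho>) powr a * \<epsilon> \<le> (2 / \<rho>) powr a * (c0 * (\<rho> / 2) powr a)"
    by (intro mult_left_mono) (auto simp: \<epsilon>_def)
  also have "\<dots> = c0" using \<rho>(1) by (simp add: powr_divide)
  finally have eps2: "(2 / \<rho>) powr a * \<epsilon> \<le> c0" .
  have "\<epsilon> powr p \<le> ((c0 / (2 * K)) powr (1 / p)) powr p"
    using \<epsilon> p by (intro powr_mono2) (auto simp: \<epsilon>_def)
  also have "\<dots> = c0 / (2 * K)" using p c0 K by (simp add: powr_powr)
  finally have "K * \<epsilon> powr p \<le> K * (c0 / (2 * K))" using K by (intro mult_left_mono) auto
  also have "\<dots> = c0 / 2" using K by simp
  finally have eps3: "K * \<epsilon> powr p \<le> c0 / 2" .
  define X where "X = cball (0 :: real^'n) ((R + R') / 2)"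
  interpret uniform_moving_sphere a p \<Sigma> \<Omega> u h X \<rho> c0 M \<epsilon>
  proof (intro uniform_moving_sphere.intro uniform_moving_sphere_axioms.intro)
    show "singular_solution a p \<Sigma> \<Omega> u h" by (fact singular_solution_axioms)
    fix x assume x: "x \<in> X"
    have sub: "cball x \<rho> \<subseteq> Q"
    proof
      fix y assume "y \<in> cball x \<rho>"
      then show "y \<in> Q"
        using x dist_triangle[of 0 y x] \<rho>(2) by (simp add: X_def Q_def)
    qed
    show "moving_sphere a p \<Sigma> \<Omega> u h x \<rho> c0 M \<epsilon>"
    proof
      show "cball x \<rho> \<subseteq> \<Omega>" using sub Q(3) by (simp add: \<Omega>_def)
      show "c0 \<le> h y" if "y \<in> cball x \<rho>" for y using c0_le sub that by blast
      show "h y \<le> h y' * exp (M * norm (y - y'))" if "y \<in> cball x \<rho>" "y' \<in> cball x \<rho>" for y y'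
        using h_lip sub that by blast
      show "6 * 2 powr a * unit_ball_vol CARD('n) / \<rho> ^ CARD('n) * \<epsilon> powr p \<le> c0 / 2"
        using eps3 by (simp add: K_def)
    qed (use \<rho>(1) c0 M M\<rho> \<epsilon> eps2 in auto)
  qed (fact \<rho>(1))
  obtain \<delta> where \<delta>: "0 < \<delta>" and reach: "\<forall>z\<in>\<Sigma>. \<forall>v\<in>orthogonal_comp (tangent_space \<Sigma> z).
      norm v < \<delta> \<longrightarrow> ball (z + v) (norm v) \<inter> \<Sigma> = {}"
    using tubular_neighborhood_reach[OF closed_mf(1) assms(5)] by (elim exE conjE)
  define L where "L = blowup_scale a p CARD('n)"
  have L: "0 < L" unfolding L_def by (rule blowup_scale_pos) simp
  \<comment> \<open>The four bounds serve, in order, the sphere size, the \<epsilon>-smallness, the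
    inclusion of \<open>ball z (3 * D0)\<close> in \<open>X\<close>, and the reach of
    \<Sigma>.\<close>
  define D0 where "D0 = min (min (\<rho> / 4) (\<epsilon> powr (2 / a) / (16 * L))) (min ((R' - R) / 6) (\<delta> / 2))"
  have D0: "0 < D0" "D0 \<le> \<rho> / 4" "D0 \<le> \<epsilon> powr (2 / a) / (16 * L)" "D0 \<le> (R' - R) / 6" "D0 \<le> \<delta> / 2"
  proof -
    show "0 < D0" using \<rho>(1) \<epsilon> L R \<delta> by (simp add: D0_def)
  qed (simp_all only: D0_def min.coboundedI1 min.coboundedI2 order_refl)
  have "16 * L * D0 \<le> \<epsilon> powr (2 / a)" using D0(3) L by (simp add: field_simps)
  then have "(16 * L * D0) powr (a / 2) \<le> (\<epsilon> powr (2 / a)) powr (a / 2)"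
    using L D0(1) a by (intro powr_mono2) auto
  also have "\<dots> = \<epsilon>" using a \<epsilon> by (simp add: powr_powr)
  finally have D0_eps: "(16 * L * D0) powr (a / 2) \<le> \<epsilon>" .
  have ball_z: "ball z (3 * D0) \<subseteq> X \<inter> \<Omega>" if z: "z \<in> A" for z
  proof
    fix y assume y: "y \<in> ball z (3 * D0)"
    have "norm z \<le> R" using z0(2)[OF z] by (simp add: R_def)
    then have "norm y \<le> (R + R') / 2"
      using y dist_triangle[of 0 y z] D0(4) by simp
    then show "y \<in> X \<inter> \<Omega>" using R by (simp add: X_def \<Omega>_def)
  qed
  define b where "b = D0 / 2"
  have b: "0 < b" using D0(1) by (simp add: b_def)
  \<comment> \<open>\<open>r < b\<close> gives \<open>r + b \<le> D0\<close>;
    \<open>r < b / a\<close> keeps the exponent \<open>a * r / b\<close> below 1 for the final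
    linearization.\<close>
  define r0 where "r0 = min b (b / a)"
  have r0: "0 < r0" using b a by (simp add: r0_def)
  have harnack: "u x1 \<le> exp (a * r / b) * u x2"
    and in_dom: "x2 \<in> \<Omega> - \<Sigma>"
    if r: "0 < r" "r < r0" and z: "z \<in> A"
      and x12: "x1 \<in> fibre_sphere N P r z" "x2 \<in> fibre_sphere N P r z" for r z x1 x2
  proof -
    note f1 = fibre_sphere_normal[OF assms(5) x12(1)]
    note f2 = fibre_sphere_normal[OF assms(5) x12(2)]
    have rb: "r < b" using r by (simp add: r0_def)
    then have r\<delta>: "r + b < \<delta>" "r + b \<le> D0" using D0(1,5) by (auto simp: b_def)
    \<comment> \<open>This ball is centred at \<open>x2\<close> itself, so being disjoint from
      \<Sigma> puts \<open>x2\<close> off \<Sigma>.\<close>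
    have "ball (z + (x2 - z)) (norm (x2 - z)) \<inter> \<Sigma> = {}"
      using reach f2 r\<delta>(1) b by (intro reach[rule_format]) auto
    moreover have "x2 \<in> ball (z + (x2 - z)) (norm (x2 - z))" using f2(3) r(1) by simp
    ultimately have x2: "x2 \<notin> \<Sigma>" by blast
    have "x2 \<in> ball z (3 * D0)"
      using f2(3) rb D0(1) by (simp add: b_def dist_norm norm_minus_commute)
    then show dom: "x2 \<in> \<Omega> - \<Sigma>" using ball_z[OF z] x2 by blast
    show "u x1 \<le> exp (a * r / b) * u x2"
    proof (cases "x1 = x2")
      case True
      have "1 \<le> exp (a * r / b)" using a b r by simp
      then show ?thesis using True u_pos[OF dom] by simp
    next
      case False
      define \<tau> where "\<tau> = norm (x1 - x2)"
      define x where "x = x1 + (b / \<tau>) *\<^sub>R (x1 - x2)"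
      have \<tau>: "0 < \<tau>" using False by (simp add: \<tau>_def)
      have \<tau>r: "\<tau> \<le> 2 * r"
        using norm_triangle_ineq4[of "x1 - z" "x2 - z"] f1(3) f2(3) by (simp add: \<tau>_def)
      have xz: "x - z = (x1 - z) + (b / \<tau>) *\<^sub>R ((x1 - z) - (x2 - z))" by (simp add: x_def)
      have normal: "x - z \<in> orthogonal_comp (tangent_space \<Sigma> z)"
        unfolding xz
        by (rule subspace_add[OF subspace_orthogonal_comp f1(2) subspace_scale[OF subspace_orthogonal_comp
              subspace_diff[OF subspace_orthogonal_comp f1(2) f2(2)]]])
      have "norm (x - z) \<le> norm (x1 - z) + norm ((b / \<tau>) *\<^sub>R ((x1 - z) - (x2 - z)))"
        unfolding xz by (rule norm_triangle_ineq)
      also have "\<dots> = r + b" using f1(3) \<tau> b by (simp add: \<tau>_def)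
      finally have "norm (x - z) < \<delta>" using r\<delta>(1) by simp
      then have "ball (z + (x - z)) (norm (x - z)) \<inter> \<Sigma> = {}"
        using normal f1(1) by (intro reach[rule_format])
      then have disj: "ball x (norm (x - z)) \<inter> \<Sigma> = {}" by simp
      have "(b / (b + \<tau>)) powr (a / 2) * u x1 \<le> u x2"
        unfolding \<tau>_def
        by (rule fibre_comparison[where z = z and r = r and ?D0.0 = D0])
          (use f1 f2 False x2 r b r\<delta> D0(2) D0_eps ball_z[OF z] disj in
            \<open>simp_all add: L_def[symmetric] \<tau>_def[symmetric] x_def[symmetric]\<close>)
      \<comment> \<open>\<open>\<tau> \<le> 2 * r\<close> and \<open>1 + t \<le> exp t\<close> turn
        the fixed offset \<open>b\<close> into an exponent linear in \<open>r\<close>.\<close>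
      moreover have "exp (- (a * r / b)) \<le> (b / (b + \<tau>)) powr (a / 2)"
      proof -
        have "(b + \<tau>) / b \<le> 1 + 2 * r / b" using b \<tau>r by (simp add: add_divide_distrib divide_right_mono)
        also have "\<dots> \<le> exp (2 * r / b)" by (rule exp_ge_add_one_self)
        finally have "ln ((b + \<tau>) / b) \<le> ln (exp (2 * r / b))"
          using b \<tau> by (intro ln_mono) auto
        then have "- (2 * r / b) \<le> ln (b / (b + \<tau>))"
          using b \<tau> by (simp add: ln_div)
        then have "a / 2 * (- (2 * r / b)) \<le> a / 2 * ln (b / (b + \<tau>))"
          using a by (intro mult_left_mono) auto
        then show ?thesis using b \<tau> by (simp add: powr_def)
      qed
      then have "exp (- (a * r / b)) * u x1 \<le> (b / (b + \<tau>)) powr (a / 2) * u x1"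
      proof (rule mult_right_mono)
        have "ball (z + (x1 - z)) (norm (x1 - z)) \<inter> \<Sigma> = {}"
          using f1 r\<delta>(1) b by (intro reach[rule_format]) auto
        moreover have "x1 \<in> ball (z + (x1 - z)) (norm (x1 - z))" using f1(3) r(1) by simp
        ultimately have "x1 \<notin> \<Sigma>" by blast
        moreover have "x1 \<in> ball z (3 * D0)"
          using f1(3) rb D0(1) by (simp add: b_def dist_norm norm_minus_commute)
        ultimately show "0 \<le> u x1" using ball_z[OF z] by (intro less_imp_le[OF u_pos]) blast
      qed
      ultimately have "exp (- (a * r / b)) * u x1 \<le> u x2" by simp
      then have "exp (a * r / b) * (exp (- (a * r / b)) * u x1) \<le> exp (a * r / b) * u x2"
        by (intro mult_left_mono) auto
      then show ?thesis by (simp add: mult.assoc[symmetric] flip: exp_add)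
    qed
  qed
  have "\<bar>u x / u x' - 1\<bar> \<le> 2 * a / b * r"
    if r: "0 < r" "r < r0" and z: "z \<in> A"
      and xs: "x \<in> fibre_sphere N P r z" "x' \<in> fibre_sphere N P r z" for r z x x'
  proof -
    define t where "t = a * r / b"
    have "r < b / a" using r by (simp add: r0_def)
    then have t: "0 \<le> t" "t \<le> 1" using a b r by (auto simp: t_def field_simps)
    have pos: "0 < u x'" using in_dom[OF r z xs] by (rule u_pos)
    have "u x / u x' \<le> exp t"
      using harnack[OF r z xs] pos by (simp add: t_def field_simps)
    moreover have "exp (- t) \<le> u x / u x'"
      using harnack[OF r z xs(2,1)] pos by (simp add: t_def exp_minus field_simps)
    ultimately have "\<bar>u x / u x' - 1\<bar> \<le> 2 * t" using t by (intro exp_close_to_1)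
    then show ?thesis by (simp add: t_def)
  qed
  moreover have "0 < 2 * a / b" using a b by simp
  ultimately show ?thesis using r0 by blast
qed

end
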